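(* Let $q\in[1/2,1)$ and $\lambda>0$, and let $T\in\mathcal{L}^{|}$ be a random tree distributed as the exponential invariant Galton-Watson tree $\mathcal{IGW}(q,\lambda)$. Then the height of $T$ has the cumulative distribution function $$H(x)=\mathsf{P}\big(\mathrm{height}(T)\le x\big)=1-\big(\lambda(1-q)x+1\big)^{-q/(1-q)},\qquad x\ge 0.$$
   Context: A rooted tree is reduced if it has no vertices of degree 2 except possibly the root, and planted if its root has degree one; the only edge at the root is then called the stem. $\mathcal{T}^{|}$ is the space of finite unlabeled rooted reduced planted trees without planar embedding, together with the empty tree $\phi$ (a root and no edges); $\mathcal{L}^{|}$ is the space of such trees equipped with positive edge lengths (metric trees). $\mathrm{shape}(T)$ is the combinatorial tree underlying a metric tree $T$. For a probability mass function $\{q_k\}_{k\ge0}$ with $q_1=0$ and $\sum_k kq_k\le 1$, $\mathcal{GW}(\{q_k\})$ is the probability measure on $\mathcal{T}^{|}$ induced by the Galton-Watson process that begins with a progenitor (the root) having exactly one offspring, after which every individual independently has $k$ offspring with probability $q_k$. For $q\in[1/2,1)$, $\mathcal{IGW}(q)$ is $\mathcal{GW}(\{q_k\})$ with progeny generating function $Q(z)=\sum_k q_kz^k=z+q(1-z)^{1/q}$. A random tree $T$ in $\mathcal{L}^{|}$ has distribution $\mathcal{IGW}(q,\lambda)$ if $\mathrm{shape}(T)$ has distribution $\mathcal{IGW}(q)$ and, conditioned on $\mathrm{shape}(T)$, the edge lengths (including the stem) are i.i.d. exponential with parameter $\lambda$. $\mathrm{height}(T)$ is the maximal distance (along the tree)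 from the root to a point of $T$. *)

theory Defs
  imports "HOL-Probability.Probability"
begin

section \<open>Rooted trees\<close>

text \<open>
  A finite rooted tree without planar embedding whose edges carry labels in \<open>'a\<close>: the root comes
  with the multiset of the edges leaving it, each paired with the tree hanging off its far end.
  Combinatorial (unlabeled) trees are \<open>unit rtree\<close>, metric trees are \<open>real rtree\<close> with the
  edge lengths as labels. \<open>Vertex {#}\<close> is the empty tree (a root and no edges).
\<close>

datatype 'a rtree = Vertex "('a \<times> 'a rtree) multiset"

definition shape :: "'a rtree \<Rightarrow> unit rtree" where
  "shape = map_rtree (\<lambda>_. ())"

primrec root_degree :: "'a rtree \<Rightarrow> nat" where
  "root_degree (Vertex C) = size C"

definition planted :: "'a rtree \<Rightarrow> bool" where
  "planted t \<longleftrightarrow> root_degree t = 1"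

text \<open>
  \<open>no_deg2_below t\<close>: when \<open>t\<close> hangs off a parent edge, none of its vertices has degree 2. The
  parent edge counts towards the degree, so degree 2 means exactly one child.
\<close>

inductive no_deg2_below :: "'a rtree \<Rightarrow> bool" where
  "size C \<noteq> 1 \<Longrightarrow> (\<And>a t. (a, t) \<in># C \<Longrightarrow> no_deg2_below t) \<Longrightarrow> no_deg2_below (Vertex C)"

primrec reduced :: "'a rtree \<Rightarrow> bool" where
  "reduced (Vertex C) \<longleftrightarrow> (\<forall>(a, t) \<in># C. no_deg2_below t)"

definition planted_trees :: "unit rtree set" where
  "planted_trees = insert (Vertex {#}) {t. planted t \<and> reduced t}"

definition metric_planted_trees :: "real rtree set" where
  "metric_planted_trees = {T. shape T \<in> planted_trees \<and> (\<forall>a \<in> set_rtree T. 0 < a)}"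

text \<open>The distances to the root of all points of a metric tree, including points inside edges.\<close>

primrec point_depths :: "real rtree \<Rightarrow> real set" where
  "point_depths (Vertex C) =
     {0} \<union> (\<Union>(a, D) \<in> set_mset (image_mset (map_prod id point_depths) C). {0..a} \<union> (\<lambda>d. a + d) ` D)"

text \<open>On trees with positive edge lengths the supremum is a maximum.\<close>

definition tree_height :: "real rtree \<Rightarrow> real" where
  "tree_height T = Sup (point_depths T)"


section \<open>Galton-Watson trees\<close>

text \<open>
  Individuals are addressed by words: \<open>v @ [i]\<close> is the \<open>i\<close>-th offspring of \<open>v\<close>, and \<open>\<xi> v\<close> is the number
  of offspring of \<open>v\<close>. \<open>family_tree \<xi> v t\<close> says that the descendants of \<open>v\<close> form the finite tree \<open>t\<close>
  (birth order forgotten); no \<open>t\<close> qualifies if \<open>v\<close> has infinitely many descendants.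
\<close>

inductive family_tree :: "(nat list \<Rightarrow> nat) \<Rightarrow> nat list \<Rightarrow> unit rtree \<Rightarrow> bool" for \<xi> where
  "(\<And>i. i < \<xi> v \<Longrightarrow> family_tree \<xi> (v @ [i]) (s i)) \<Longrightarrow>
     family_tree \<xi> v (Vertex (image_mset (\<lambda>i. ((), s i)) (mset_set {..<\<xi> v})))"

text \<open>
  The progenitor \<open>[]\<close> always has exactly one offspring. The empty tree is a dummy value for infinite
  genealogies, which have probability 0 for offspring distributions with mean at most 1 and no mass at 1.
\<close>

definition gw_tree :: "(nat list \<Rightarrow> nat) \<Rightarrow> unit rtree" where
  "gw_tree \<xi> = (if \<exists>t. family_tree (\<xi>([] := 1)) [] t
                then THE t. family_tree (\<xi>([] := 1)) [] t else Vertex {#})"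

definition GW :: "nat pmf \<Rightarrow> unit rtree measure" where
  "GW p = distr (\<Pi>\<^sub>M v \<in> (UNIV :: nat list set). measure_pmf p) (count_space UNIV) gw_tree"

text \<open>
  The generating function determines \<open>p\<close>; for \<open>q < 1\<close> it forces \<open>pmf p 1 = 0\<close> and mean 1.
\<close>

definition is_IGW :: "real \<Rightarrow> unit rtree measure \<Rightarrow> bool" where
  "is_IGW q N \<longleftrightarrow>
     (\<exists>p. (\<forall>z \<in> {0..1}. (\<lambda>k. pmf p k * z ^ k) sums (z + q * (1 - z) powr (1 / q))) \<and> N = GW p)"


section \<open>Random metric trees\<close>

primrec edge_labels :: "'a rtree \<Rightarrow> 'a multiset" where
  "edge_labels (Vertex C) = (\<Sum>(a, E) \<in># image_mset (map_prod id edge_labels) C. add_mset a E)"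

text \<open>
  A tree with distinct labels serves to name the edges of its shape: if \<open>e\<close> is such a tree then
  \<open>map_rtree l e\<close> is the metric tree in which the edge named \<open>i\<close> has length \<open>l i\<close>.
\<close>

definition distinct_labels :: "nat rtree \<Rightarrow> bool" where
  "distinct_labels e \<longleftrightarrow> (\<forall>i. count (edge_labels e) i \<le> 1)"

text \<open>
  Metric trees of a given shape are the edge-length vectors modulo the automorphisms of the shape;
  they carry the quotient of the Borel sigma-algebra, and the space of all metric trees the
  sigma-algebra of the countable disjoint union over the shapes.
\<close>

definition metric_tree_algebra :: "real rtree measure" where
  "metric_tree_algebra = sigma UNIV
     {A. \<forall>e. distinct_labels e \<longrightarrow>
           {l \<in> space (\<Pi>\<^sub>M i \<in> set_rtree e. borel). map_rtree l e \<in> A} \<in> sets (\<Pi>\<^sub>M i \<in> set_rtree e. borel)}"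

text \<open>
  The law of the metric tree obtained from \<open>shape e\<close> by giving its edges independent exponential
  lengths with parameter \<open>lam\<close>.
\<close>

definition exponential_lengths_law :: "real \<Rightarrow> nat rtree \<Rightarrow> real rtree measure" where
  "exponential_lengths_law lam e =
     distr (\<Pi>\<^sub>M i \<in> set_rtree e. density lborel (exponential_density lam))
       metric_tree_algebra (\<lambda>l. map_rtree l e)"

text \<open>
  Shapes are countably many, so conditioning on the shape is elementary conditioning on the events
  \<open>shape T = t\<close> of positive probability. The law does not depend on how the edges are named.
\<close>

definition IGW_distributed :: "'w measure \<Rightarrow> ('w \<Rightarrow> real rtree) \<Rightarrow> real \<Rightarrow> real \<Rightarrow> bool" where
  "IGW_distributed M T q lam \<longleftrightarrow>
     T \<in> measurable M metric_tree_algebra \<and>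
     (\<forall>\<omega> \<in> space M. T \<omega> \<in> metric_planted_trees) \<and>
     is_IGW q (distr M (count_space UNIV) (\<lambda>\<omega>. shape (T \<omega>))) \<and>
     (\<forall>t e. measure M {\<omega> \<in> space M. shape (T \<omega>) = t} > 0 \<longrightarrow> shape e = t \<longrightarrow> distinct_labels e \<longrightarrow>
        distr (uniform_measure M {\<omega> \<in> space M. shape (T \<omega>) = t}) metric_tree_algebra T =
        exponential_lengths_law lam e)"

end

theory Submission
  imports Defs "HOL-Library.Sublist" "HOL-Real_Asymp.Real_Asymp"
begin

text \<open>
  Let \<open>H x\<close> be the probability that the tree is finite and has height at most \<open>x\<close>. Conditioning on the
  length of the stem and on the number of branches at its far end gives the renewal equation
  \<open>H x = (\<integral> y = 0..x. lam * exp (- lam * y) * Q (H (x - y)))\<close>, which amounts to \<open>H 0 = 0\<close> and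
  \<open>H' = lam * (Q H - H) = lam * q * (1 - H) powr (1 / q)\<close>. Then \<open>(1 - H) powr (- (1 - q) / q)\<close>
  has constant slope \<open>lam * (1 - q)\<close>, which determines \<open>H\<close>. Almost sure finiteness of the tree is not
  needed beforehand: \<open>H\<close> is a lower bound for the probability of being finite, and \<open>H x\<close> tends to 1.
\<close>

section \<open>Heights of metric trees\<close>

text \<open>It is recovered in two halves. For a fixed shape, distinct names put the lengths of
  different branches on disjoint coordinates of a product space, so the probability of a height
  bound is a product over the branches. Across shapes, the sum over all lists of \<open>k\<close>
  branches factors into the \<open>k\<close>-th power of one sum; this is how the generating
  function enters. The sums run over finite trees only, so a priori they give a possibly defective
  distribution function. The recursion holds all the same, because the generating function is
  prescribed on all of \<open>{0..1}\<close>. Nor is any regularity in \<open>x\<close> known in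
  advance beyond measurability: the renewal equation itself supplies it.\<close>

lemma set_rtree_Vertex: "set_rtree (Vertex C) = (\<Union>(a, t)\<in>set_mset C. insert a (set_rtree t))"
  unfolding rtree.set by (intro SUP_cong refl) (auto split: prod.split)

lemma set_mset_edge_labels: "set_mset (edge_labels e) = set_rtree e"
proof (induction e)
  case (Vertex C)
  have "set_mset (edge_labels (Vertex C)) = (\<Union>(a, t)\<in>set_mset C. insert a (set_mset (edge_labels t)))"
    by (induction C) auto
  also have "\<dots> = set_rtree (Vertex C)"
    unfolding set_rtree_Vertex
  proof (intro SUP_cong refl)
    fix x assume "x \<in># C"
    then show "(case x of (a, t) \<Rightarrow> insert a (set_mset (edge_labels t))) = (case x of (a, t) \<Rightarrow> insert a (set_rtree t))"
      using Vertex[of x "snd x"] by (cases x) simp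
  qed
  finally show ?case .
qed

lemma finite_set_rtree: "finite (set_rtree e)"
  by (simp flip: set_mset_edge_labels)

lemma edge_labels_add_mset:
  "edge_labels (Vertex (add_mset (a, t) C)) = add_mset a (edge_labels t) + edge_labels (Vertex C)"
  by simp

lemma set_rtree_add_mset:
  "set_rtree (Vertex (add_mset (a, t) C)) = insert a (set_rtree t) \<union> set_rtree (Vertex C)"
  unfolding set_rtree_Vertex by simp

text \<open>Labels are counted with multiplicity, so a bound of one on a sum of multisets forces the
  summands to have disjoint supports. This disjointness is what later makes different branches
  independent.\<close>

lemma distinct_labels_add_mset:
  "distinct_labels (Vertex (add_mset (a, t) C)) \<longleftrightarrow>
     distinct_labels t \<and> distinct_labels (Vertex C) \<and> a \<notin> set_rtree t \<and>
     insert a (set_rtree t) \<inter> set_rtree (Vertex C) = {}" (is "?L \<longleftrightarrow> ?R")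
proof
  assume L: ?L
  have *: "(if i = a then 1 else 0) + count (edge_labels t) i + count (edge_labels (Vertex C)) i \<le> 1" for i
    using L[unfolded distinct_labels_def edge_labels_add_mset, rule_format, of i]
    by (cases "i = a") (simp_all del: edge_labels.simps)
  have mem: "i \<in> set_rtree e \<longleftrightarrow> count (edge_labels e) i \<ge> 1" for i and e :: "nat rtree"
    by (simp flip: set_mset_edge_labels)
  have "count (edge_labels t) i \<le> 1" "count (edge_labels (Vertex C)) i \<le> 1" for i
    using *[of i] by linarith+
  moreover have "\<not> count (edge_labels t) a \<ge> 1" "\<not> count (edge_labels (Vertex C)) a \<ge> 1"
    using *[of a] by (auto simp del: edge_labels.simps)
  moreover have "\<not> (count (edge_labels t) i \<ge> 1 \<and> count (edge_labels (Vertex C)) i \<ge> 1)" for i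
    using *[of i] by linarith
  ultimately show ?R
    unfolding distinct_labels_def disjoint_iff insert_iff mem by blast
next
  assume R: ?R
  have mem: "i \<in> set_rtree e \<longleftrightarrow> count (edge_labels e) i \<noteq> 0" for i and e :: "nat rtree"
    by (simp flip: set_mset_edge_labels)
  show ?L
    unfolding distinct_labels_def edge_labels_add_mset
  proof
    fix i
    have "count (edge_labels t) i \<le> 1" "count (edge_labels (Vertex C)) i \<le> 1"
      "i = a \<longrightarrow> count (edge_labels t) i = 0 \<and> count (edge_labels (Vertex C)) i = 0"
      "count (edge_labels t) i = 0 \<or> count (edge_labels (Vertex C)) i = 0"
      using R unfolding distinct_labels_def disjoint_iff insert_iff mem by blast+
    then show "count (add_mset a (edge_labels t) + edge_labels (Vertex C)) i \<le> 1"
      by (auto simp del: edge_labels.simps)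
  qed
qed

lemma shape_Vertex: "shape (Vertex C) = Vertex (image_mset (\<lambda>(a, t). ((), shape t)) C)"
  by (auto simp: shape_def intro!: image_mset_cong)

lemma shape_map_rtree: "shape (map_rtree f e) = shape e"
  by (simp add: shape_def rtree.map_comp o_def)

text \<open>The conditional law in \<open>IGW_distributed\<close> speaks of named trees, so it says
  something about a shape only once a naming exists. The lower bound \<open>n\<close> leaves room
  for the induction: each new branch is named above the finitely many labels already in use.\<close>

lemma exists_distinct_labels: "\<exists>e. shape e = t \<and> distinct_labels e \<and> set_rtree e \<subseteq> {n..}"
proof (induction t arbitrary: n)
  case (Vertex C)
  have IH: "\<exists>e. shape e = t \<and> distinct_labels e \<and> set_rtree e \<subseteq> {n..}" if "(a, t) \<in># C" for a t n
    using Vertex that by fastforce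
  then show ?case
  proof (induction C arbitrary: n)
    case empty
    show ?case
      by (rule exI[of _ "Vertex {#}"]) (auto simp: shape_Vertex distinct_labels_def)
  next
    case (add x C)
    obtain t where x: "x = ((), t)" by (cases x) auto
    have "\<exists>e. shape e = Vertex C \<and> distinct_labels e \<and> set_rtree e \<subseteq> {n..}"
      by (rule add.IH, rule add.prems) simp
    then obtain D where D: "shape (Vertex D) = Vertex C" "distinct_labels (Vertex D)" "set_rtree (Vertex D) \<subseteq> {n..}"
      by (metis rtree.exhaust)
    \<comment> \<open>\<open>m\<close> exceeds \<open>n\<close> and all labels used so far; it names
      the new edge, and the branch behind that edge takes labels from \<open>Suc m\<close>
      on.\<close>
    define m where "m = Suc (Max (insert n (set_rtree (Vertex D))))"
    have m: "i < m" if "i \<in> insert n (set_rtree (Vertex D))" for i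
      unfolding m_def using that finite_set_rtree by (meson Max_ge finite.insertI le_imp_less_Suc)
    obtain e where e: "shape e = t" "distinct_labels e" "set_rtree e \<subseteq> {Suc m..}"
      using add.prems[of "()" t "Suc m"] x by auto
    have "distinct_labels (Vertex (add_mset (m, e) D))"
      unfolding distinct_labels_add_mset
    proof (intro conjI)
      show "m \<notin> set_rtree e" using e by auto
      show "insert m (set_rtree e) \<inter> set_rtree (Vertex D) = {}"
      proof (rule ccontr)
        assume "\<not> ?thesis"
        then obtain i where i: "i = m \<or> i \<in> set_rtree e" "i \<in> set_rtree (Vertex D)" by blast
        then have "m \<le> i" using e(3) by fastforce
        with m[of i] i(2) show False by simp
      qed
    qed (use D(2) e(2) in blast)+
    moreover have "set_rtree (Vertex (add_mset (m, e) D)) \<subseteq> {n..}"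
      unfolding set_rtree_add_mset using D(3) e(3) m[of n] by fastforce
    moreover have "shape (Vertex (add_mset (m, e) D)) = Vertex (add_mset x C)"
      using D(1) e(1) x by (simp add: shape_Vertex)
    ultimately show ?case by blast
  qed
qed

section \<open>Height of a tree in terms of its branches\<close>

lemma zero_in_point_depths: "0 \<in> point_depths t"
  by (cases t) simp

lemma point_depths_Vertex:
  "point_depths (Vertex C) = {0} \<union> (\<Union>(a, t)\<in>set_mset C. {0..a} \<union> (\<lambda>d. a + d) ` point_depths t)"
  by fastforce

lemma bdd_above_point_depths: "bdd_above (point_depths t)"
proof (induction t)
  case (Vertex C)
  have "bdd_above (point_depths t)" if "(a, t) \<in># C" for a t
    using Vertex that by fastforce
  then show ?case
    unfolding point_depths_Vertex
    by (auto intro!: bdd_above_image_mono monoI)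
qed

text \<open>Points inside an edge lie no deeper than its far end, which has depth 0 in the branch
  behind it. Bounding the height instead of computing it avoids a maximum over a possibly empty
  multiset; the root accounts for \<open>0 \<le> c\<close>.\<close>

lemma tree_height_Vertex_le_iff:
  "tree_height (Vertex C) \<le> c \<longleftrightarrow> 0 \<le> c \<and> (\<forall>(a, t)\<in>set_mset C. a + tree_height t \<le> c)"
proof -
  have le: "tree_height t \<le> c \<longleftrightarrow> (\<forall>d\<in>point_depths t. d \<le> c)" for t c
    unfolding tree_height_def using bdd_above_point_depths zero_in_point_depths
    by (subst cSup_le_iff) auto
  have "(\<forall>d\<in>{0..a} \<union> (\<lambda>d. a + d) ` point_depths t. d \<le> c) \<longleftrightarrow> a + tree_height t \<le> c" if "0 \<le> c" for a t
  proof -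
    have "a + tree_height t \<le> c \<longleftrightarrow> (\<forall>d\<in>point_depths t. a + d \<le> c)"
      using le[of t "c - a"] by (auto simp: algebra_simps)
    moreover have "a \<le> c" if "\<forall>d\<in>point_depths t. a + d \<le> c"
      using that zero_in_point_depths[of t] by force
    ultimately show ?thesis by auto
  qed
  then show ?thesis
    unfolding le point_depths_Vertex by (auto simp: split_beta)
qed

section \<open>Measurability of the height and of the shape\<close>

lemma map_rtree_Vertex: "map_rtree l (Vertex C) = Vertex (image_mset (\<lambda>(a, t). (l a, map_rtree l t)) C)"
  by (auto intro!: image_mset_cong)

text \<open>The index set \<open>I\<close> may exceed the labels of \<open>e\<close>, because the
  induction descends to subtrees while the product space stays fixed.\<close>

lemma measurable_tree_height_map:
  assumes "set_rtree e \<subseteq> I"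
  shows "(\<lambda>l. tree_height (map_rtree l e)) \<in> borel_measurable (\<Pi>\<^sub>M i\<in>I. borel)"
  using assms
proof (induction e)
  case (Vertex C)
  have [measurable]: "(\<lambda>l. tree_height (map_rtree l t)) \<in> borel_measurable (\<Pi>\<^sub>M i\<in>I. borel)"
     "(\<lambda>l. l a) \<in> borel_measurable (\<Pi>\<^sub>M i\<in>I. borel)" if "(a, t) \<in># C" for a t
  proof -
    show "(\<lambda>l. l a) \<in> borel_measurable (\<Pi>\<^sub>M i\<in>I. borel)"
      using Vertex.prems that by (intro measurable_component_singleton) fastforce
    show "(\<lambda>l. tree_height (map_rtree l t)) \<in> borel_measurable (\<Pi>\<^sub>M i\<in>I. borel)"
      using Vertex.prems that by (intro Vertex.IH[of "(a, t)"]) fastforce+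
  qed
  show ?case
    unfolding borel_measurable_iff_le
  proof
    fix c :: real
    have "{l \<in> space (\<Pi>\<^sub>M i\<in>I. borel). \<forall>x\<in>set_mset C. l (fst x) + tree_height (map_rtree l (snd x)) \<le> c}
        \<in> sets (\<Pi>\<^sub>M i\<in>I. borel)"
      by (intro sets.sets_Collect_finite_All borel_measurable_le borel_measurable_add) auto
    then show "{l \<in> space (\<Pi>\<^sub>M i\<in>I. borel). tree_height (map_rtree l (Vertex C)) \<le> c} \<in> sets (\<Pi>\<^sub>M i\<in>I. borel)"
      unfolding map_rtree_Vertex tree_height_Vertex_le_iff
      by (cases "0 \<le> c") (auto simp: split_beta)
  qed
qed

lemma space_metric_tree_algebra [simp]: "space metric_tree_algebra = UNIV"
  by (simp add: metric_tree_algebra_def space_measure_of_conv)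

lemma sets_metric_tree_algebraI:
  assumes "\<And>e. distinct_labels e \<Longrightarrow>
    {l \<in> space (\<Pi>\<^sub>M i\<in>set_rtree e. borel). map_rtree l e \<in> A} \<in> sets (\<Pi>\<^sub>M i\<in>set_rtree e. borel)"
  shows "A \<in> sets metric_tree_algebra"
  unfolding metric_tree_algebra_def using assms by (simp add: sets_measure_of)

lemma measurable_tree_height [measurable]: "tree_height \<in> borel_measurable metric_tree_algebra"
proof (rule measurableI)
  fix A :: "real set" assume A: "A \<in> sets borel"
  show "tree_height -` A \<inter> space metric_tree_algebra \<in> sets metric_tree_algebra"
    using measurable_sets[OF measurable_tree_height_map[OF order_refl] A]
    by (intro sets_metric_tree_algebraI) (simp add: vimage_def Int_def conj_commute)
qed simp

lemma measurable_shape [measurable]: "shape \<in> measurable metric_tree_algebra (count_space UNIV)"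
  by (rule measurableI) (auto intro!: sets_metric_tree_algebraI simp: shape_map_rtree)

lemma measurable_map_rtree:
  assumes "distinct_labels e"
  shows "(\<lambda>l. map_rtree l e) \<in> measurable (\<Pi>\<^sub>M i\<in>set_rtree e. borel) metric_tree_algebra"
  unfolding metric_tree_algebra_def
  using assms by (intro measurable_measure_of) (simp_all add: vimage_def Int_def conj_commute)

section \<open>The height given the shape\<close>

abbreviation exp_law :: "real \<Rightarrow> real measure" where
  "exp_law lam \<equiv> density lborel (exponential_density lam)"

text \<open>
  The conditional distribution function of the height given the shape. Being \<open>0\<close> at negative
  arguments, it turns the integral over all edge lengths into the convolution on \<open>[0, x]\<close>.
\<close>

primrec height_cdf :: "real \<Rightarrow> 'a rtree \<Rightarrow> real \<Rightarrow> ennreal" where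
  "height_cdf lam (Vertex C) = (\<lambda>x. if 0 \<le> x
     then \<Prod>(_, F)\<in>#image_mset (map_prod id (height_cdf lam)) C. \<integral>\<^sup>+y. F (x - y) \<partial>exp_law lam
     else 0)"

lemma height_cdf_Vertex:
  "height_cdf lam (Vertex C) x =
     (if 0 \<le> x then \<Prod>(_, t)\<in>#C. \<integral>\<^sup>+y. height_cdf lam t (x - y) \<partial>exp_law lam else 0)"
  by (simp add: image_mset.compositionality o_def case_prod_unfold)

text \<open>The recursion never reads a label, so a result for a named tree carries over to its
  shape.\<close>

lemma height_cdf_shape: "height_cdf lam (shape t) = height_cdf lam t"
proof (induction t)
  case (Vertex C)
  then have "height_cdf lam (shape t) = height_cdf lam t" if "(a, t) \<in># C" for a t
    using that by fastforce
  then show ?case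
    unfolding shape_Vertex height_cdf_Vertex fun_eq_iff
    by (auto simp: image_mset.compositionality o_def case_prod_unfold intro!: arg_cong[of _ _ prod_mset] image_mset_cong)
qed

lemma measurable_prod_mset:
  assumes "\<And>x. x \<in># A \<Longrightarrow> (\<lambda>w. f x w) \<in> borel_measurable M"
  shows "(\<lambda>w. \<Prod>x\<in>#A. f x w :: ennreal) \<in> borel_measurable M"
  using assms by (induction A) simp_all

lemma measurable_height_cdf:
  assumes "0 < lam"
  shows "height_cdf lam t \<in> borel_measurable borel"
proof (induction t)
  case (Vertex C)
  have IH: "height_cdf lam t \<in> borel_measurable borel" if "(a, t) \<in># C" for a t
    using Vertex that by fastforce
  have "(\<lambda>x. \<integral>\<^sup>+y. height_cdf lam t (x - y) \<partial>exp_law lam) \<in> borel_measurable borel" if "(a, t) \<in># C" for a t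
  proof -
    note IH[OF that, measurable]
    interpret sigma_finite_measure "exp_law lam"
      using assms by (intro prob_space_imp_sigma_finite prob_space_exponential_density)
    show ?thesis by measurable
  qed
  then have [measurable]: "(\<lambda>x. \<Prod>(_, t)\<in>#C. \<integral>\<^sup>+y. height_cdf lam t (x - y) \<partial>exp_law lam) \<in> borel_measurable borel"
    unfolding split_beta by (intro measurable_prod_mset) auto
  show ?case
    unfolding height_cdf_Vertex[abs_def] by measurable
qed

section \<open>Product measures over disjoint index sets\<close>

lemma sets_PiM_Un:
  assumes "A \<in> sets (PiM I M)" "B \<in> sets (PiM J M)"
  shows "{l \<in> space (PiM (I \<union> J) M). restrict l I \<in> A \<and> restrict l J \<in> B} \<in> sets (PiM (I \<union> J) M)" (is "?X \<in> _")
proof -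
  have "?X = ((\<lambda>l. restrict l I) -` A \<inter> space (PiM (I \<union> J) M)) \<inter> ((\<lambda>l. restrict l J) -` B \<inter> space (PiM (I \<union> J) M))"
    by auto
  also have "\<dots> \<in> sets (PiM (I \<union> J) M)"
    by (intro sets.Int measurable_sets[OF measurable_restrict_subset] assms) auto
  finally show ?thesis .
qed

text \<open>Pulled back along \<open>merge\<close>, whose two restrictions recover its arguments,
  the event becomes the rectangle \<open>A \<times> B\<close>.\<close>

lemma (in product_sigma_finite) emeasure_PiM_Un:
  assumes "finite I" "finite J" "I \<inter> J = {}" "A \<in> sets (PiM I M)" "B \<in> sets (PiM J M)"
  shows "emeasure (PiM (I \<union> J) M) {l \<in> space (PiM (I \<union> J) M). restrict l I \<in> A \<and> restrict l J \<in> B} =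
    emeasure (PiM I M) A * emeasure (PiM J M) B"
proof -
  interpret J: sigma_finite_measure "PiM J M" using assms by (intro sigma_finite)
  let ?X = "{l \<in> space (PiM (I \<union> J) M). restrict l I \<in> A \<and> restrict l J \<in> B}"
  have [measurable]: "?X \<in> sets (PiM (I \<union> J) M)"
    using assms by (intro sets_PiM_Un)
  have "emeasure (PiM (I \<union> J) M) ?X = emeasure (PiM I M \<Otimes>\<^sub>M PiM J M) (merge I J -` ?X \<inter> space (PiM I M \<Otimes>\<^sub>M PiM J M))"
    by (subst distr_merge[OF assms(3,1,2), symmetric], subst emeasure_distr) auto
  also have "merge I J -` ?X \<inter> space (PiM I M \<Otimes>\<^sub>M PiM J M) = A \<times> B"
  proof -
    have "merge I J (a, b) \<in> ?X \<longleftrightarrow> a \<in> A \<and> b \<in> B" if "a \<in> space (PiM I M)" "b \<in> space (PiM J M)" for a b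
    proof -
      have "merge I J (a, b) \<in> space (PiM (I \<union> J) M)"
        using measurable_space[OF measurable_merge, of "(a, b)" I M J] that by (simp add: space_pair_measure)
      moreover have "restrict (merge I J (a, b)) I = a" "restrict (merge I J (a, b)) J = b"
        using that assms(3) by (simp_all add: space_PiM PiE_restrict)
      ultimately show ?thesis by simp
    qed
    then show ?thesis
      using sets.sets_into_space[OF assms(4)] sets.sets_into_space[OF assms(5)]
      by (auto simp: space_pair_measure)
  qed
  also have "emeasure (PiM I M \<Otimes>\<^sub>M PiM J M) (A \<times> B) = emeasure (PiM I M) A * emeasure (PiM J M) B"
    using assms by (intro J.emeasure_pair_measure_Times)
  finally show ?thesis .
qed

lemma sets_PiM_exp_law [simp, measurable_cong]:
  "sets (\<Pi>\<^sub>M i\<in>I. exp_law lam) = sets (\<Pi>\<^sub>M i\<in>I. borel)"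
  by (intro sets_PiM_cong) simp_all

lemma map_rtree_restrict: "set_rtree e \<subseteq> I \<Longrightarrow> map_rtree (restrict l I) e = map_rtree l e"
  by (intro rtree.map_cong0) auto

text \<open>For a single branch the length of its first edge is integrated last, which shifts the
  bound from \<open>x\<close> to \<open>x - y\<close>. Several branches use disjoint sets of
  coordinates, so their events multiply.\<close>

lemma emeasure_tree_height_le:
  fixes e :: "nat rtree"
  assumes "0 < lam" "distinct_labels e"
  defines "P \<equiv> \<lambda>I. \<Pi>\<^sub>M i\<in>I. exp_law lam"
  shows "emeasure (P (set_rtree e)) {l \<in> space (P (set_rtree e)). tree_height (map_rtree l e) \<le> x} = height_cdf lam e x"
  using assms(2)
proof (induction e arbitrary: x)
  case (Vertex C)
  interpret prob_space "exp_law lam"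
    using assms(1) by (rule prob_space_exponential_density)
  interpret product_sigma_finite "\<lambda>_::nat. exp_law lam" ..
  have setsP [measurable_cong, simp]: "sets (P I) = sets (\<Pi>\<^sub>M i\<in>I. borel)" for I
    by (simp add: P_def)
  have IH: "emeasure (P (set_rtree t)) {l \<in> space (P (set_rtree t)). tree_height (map_rtree l t) \<le> x} = height_cdf lam t x"
    if "(a, t) \<in># C" "distinct_labels t" for a t x
    using Vertex.IH[of "(a, t)" t] that by fastforce
  have hm: "{l \<in> space (P I). tree_height (map_rtree l t) \<le> x} \<in> sets (P I)" if "set_rtree t \<subseteq> I" for t I x
  proof -
    have [measurable]: "(\<lambda>l. tree_height (map_rtree l t)) \<in> borel_measurable (P I)"
      unfolding measurable_cong_sets[OF setsP refl] by (intro measurable_tree_height_map that)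
    show ?thesis by measurable
  qed
  have *: "emeasure (P (insert a (set_rtree t))) {l \<in> space (P (insert a (set_rtree t))). l a + tree_height (map_rtree l t) \<le> x}
        = (\<integral>\<^sup>+y. height_cdf lam t (x - y) \<partial>exp_law lam)" and
    **: "{l \<in> space (P (insert a (set_rtree t))). l a + tree_height (map_rtree l t) \<le> x} \<in> sets (P (insert a (set_rtree t)))"
    if "(a, t) \<in># C" "distinct_labels t" "a \<notin> set_rtree t" for a t x
  proof -
    let ?I = "set_rtree t"
    let ?X = "{l \<in> space (P (insert a ?I)). l a + tree_height (map_rtree l t) \<le> x}"
    have [measurable]: "(\<lambda>l. tree_height (map_rtree l t)) \<in> borel_measurable (P (insert a ?I))"
      unfolding measurable_cong_sets[OF setsP refl] by (intro measurable_tree_height_map) auto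
    have [measurable]: "(\<lambda>l. l a) \<in> borel_measurable (P (insert a ?I))"
      by (subst measurable_cong_sets[OF setsP refl]) (rule measurable_component_singleton, simp)
    show **: "?X \<in> sets (P (insert a ?I))" by measurable
    have "emeasure (P (insert a ?I)) ?X = (\<integral>\<^sup>+l. indicator ?X l \<partial>P (insert a ?I))"
      using ** by simp
    \<comment> \<open>The coordinate \<open>a\<close> moves to the outer integral. Since
      \<open>a\<close> is no label of \<open>t\<close>, fixing it at \<open>y\<close> leaves the
      tree named by \<open>t\<close> unchanged.\<close>
    also have "\<dots> = (\<integral>\<^sup>+y. (\<integral>\<^sup>+l. indicator ?X (l(a := y)) \<partial>P ?I) \<partial>exp_law lam)"
      unfolding P_def
      using ** that(3) by (intro product_nn_integral_insert_rev finite_set_rtree) (auto simp: P_def)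
    also have "\<dots> = (\<integral>\<^sup>+y. height_cdf lam t (x - y) \<partial>exp_law lam)"
    proof (intro nn_integral_cong)
      fix y :: real
      have "map_rtree (l(a := y)) t = map_rtree l t" for l
        using that(3) by (intro rtree.map_cong0) auto
      moreover have "l(a := y) \<in> space (P (insert a ?I))" if "l \<in> space (P ?I)" for l
        using that by (auto simp: P_def space_PiM PiE_def extensional_def)
      ultimately have "(\<integral>\<^sup>+l. indicator ?X (l(a := y)) \<partial>P ?I) =
          (\<integral>\<^sup>+l. indicator {l \<in> space (P ?I). tree_height (map_rtree l t) \<le> x - y} l \<partial>P ?I)"
        by (intro nn_integral_cong) (auto simp: indicator_def algebra_simps)
      also have "\<dots> = height_cdf lam t (x - y)"
        using hm[OF order_refl, of t] by (simp add: IH[OF that(1,2)])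
      finally show "(\<integral>\<^sup>+l. indicator ?X (l(a := y)) \<partial>P ?I) = height_cdf lam t (x - y)" .
    qed
    finally show "emeasure (P (insert a ?I)) ?X = (\<integral>\<^sup>+y. height_cdf lam t (x - y) \<partial>exp_law lam)" .
  qed
  \<comment> \<open>The event omits the condition \<open>0 \<le> x\<close> of the root, so for no
    branches it is the whole one-point space and the product starts at 1. Letting \<open>D\<close>
    range over sub-multisets of \<open>C\<close> keeps the outer induction hypothesis usable for
    every branch added.\<close>
  define A where "A x D = {l \<in> space (P (set_rtree (Vertex D))). \<forall>(a, t)\<in>set_mset D. l a + tree_height (map_rtree l t) \<le> x}"
    for x and D :: "(nat \<times> nat rtree) multiset"
  have "A x D \<in> sets (P (set_rtree (Vertex D))) \<and>
      emeasure (P (set_rtree (Vertex D))) (A x D) = (\<Prod>(_, t)\<in>#D. \<integral>\<^sup>+y. height_cdf lam t (x - y) \<partial>exp_law lam)"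
    if "D \<subseteq># C" "distinct_labels (Vertex D)" for D
    using that
  proof (induction D)
    case empty
    then show ?case
      by (simp add: A_def P_def PiM_empty)
  next
    case (add z D)
    obtain a t where z: "z = (a, t)" by (cases z)
    have D: "distinct_labels t" "distinct_labels (Vertex D)" "a \<notin> set_rtree t"
      "insert a (set_rtree t) \<inter> set_rtree (Vertex D) = {}"
      using add.prems(2) unfolding z distinct_labels_add_mset by blast+
    have zC: "(a, t) \<in># C" "D \<subseteq># C"
      using add.prems(1) z by (auto dest: mset_subset_eqD mset_subset_eq_insertD simp: subset_mset.less_imp_le)
    let ?I = "insert a (set_rtree t)" and ?J = "set_rtree (Vertex D)"
    let ?X = "{l \<in> space (P ?I). l a + tree_height (map_rtree l t) \<le> x}"
    have fin: "finite ?I" "finite ?J" using finite_set_rtree by (simp_all only: finite_insert)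
    have Dm: "A x D \<in> sets (P ?J)"
      and De: "emeasure (P ?J) (A x D) = (\<Prod>(_, t)\<in>#D. \<integral>\<^sup>+y. height_cdf lam t (x - y) \<partial>exp_law lam)"
      using add.IH zC D by auto
    have eq: "A x (add_mset (a, t) D) = {l \<in> space (P (?I \<union> ?J)). restrict l ?I \<in> ?X \<and> restrict l ?J \<in> A x D}"
    proof -
      have "restrict l ?I \<in> space (P ?I)" "restrict l ?J \<in> space (P ?J)" if "l \<in> space (P (?I \<union> ?J))" for l
        using that by (auto simp: P_def space_PiM simp del: rtree.set)
      moreover have "restrict l ?I a + tree_height (map_rtree (restrict l ?I) t) = l a + tree_height (map_rtree l t)" for l
        by (subst map_rtree_restrict) auto
      moreover have "restrict l ?J b + tree_height (map_rtree (restrict l ?J) u) = l b + tree_height (map_rtree l u)"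
        if "(b, u) \<in># D" for b u l
        using that by (subst map_rtree_restrict) (force simp: set_rtree_Vertex simp del: rtree.set)+
      ultimately show ?thesis
        unfolding A_def set_rtree_add_mset by auto
    qed
    have "emeasure (P (?I \<union> ?J)) {l \<in> space (P (?I \<union> ?J)). restrict l ?I \<in> ?X \<and> restrict l ?J \<in> A x D} =
        emeasure (P ?I) ?X * emeasure (P ?J) (A x D)"
      unfolding P_def
      by (rule emeasure_PiM_Un) (use fin D(4) **[OF zC(1) D(1,3)] Dm in \<open>auto simp: P_def simp del: rtree.set\<close>)
    moreover have "A x (add_mset (a, t) D) \<in> sets (P (set_rtree (Vertex (add_mset (a, t) D))))"
      unfolding eq set_rtree_add_mset unfolding P_def
      by (rule sets_PiM_Un) (use **[OF zC(1) D(1,3)] Dm in \<open>auto simp: P_def simp del: rtree.set\<close>)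
    ultimately show ?case
      unfolding z set_rtree_add_mset eq De *[OF zC(1) D(1,3)] by simp
  qed
  from this[of C] Vertex.prems have A: "emeasure (P (set_rtree (Vertex C))) (A x C) = (\<Prod>(_, t)\<in>#C. \<integral>\<^sup>+y. height_cdf lam t (x - y) \<partial>exp_law lam)"
    by simp
  have "{l \<in> space (P (set_rtree (Vertex C))). tree_height (map_rtree l (Vertex C)) \<le> x} = (if 0 \<le> x then A x C else {})"
    unfolding map_rtree_Vertex tree_height_Vertex_le_iff A_def by auto
  then show ?case
    unfolding height_cdf_Vertex using A by simp
qed

section \<open>Galton-Watson trees as plane trees\<close>

text \<open>
  Keeping the birth order makes every event \<open>progeny of v = given tree\<close> a cylinder, so that the
  numbers of plane embeddings of an unordered tree never have to be counted.
\<close>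

datatype plane_tree = Plane "plane_tree list"

instance plane_tree :: countable
  by countable_datatype

primrec unordered :: "plane_tree \<Rightarrow> unit rtree" where
  "unordered (Plane ts) = Vertex (mset (map (\<lambda>t. ((), t)) (map unordered ts)))"

text \<open>This is the probability that the progeny of one individual, birth order kept, is exactly
  this tree.\<close>

primrec weight :: "nat pmf \<Rightarrow> plane_tree \<Rightarrow> ennreal" where
  "weight p (Plane ts) = ennreal (pmf p (length ts)) * prod_list (map (weight p) ts)"

inductive plane_family :: "(nat list \<Rightarrow> nat) \<Rightarrow> nat list \<Rightarrow> plane_tree \<Rightarrow> bool" for \<xi> where
  "\<xi> v = length ts \<Longrightarrow> (\<And>i. i < length ts \<Longrightarrow> plane_family \<xi> (v @ [i]) (ts ! i)) \<Longrightarrow>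
     plane_family \<xi> v (Plane ts)"

lemma plane_family_Plane:
  "plane_family \<xi> v (Plane ts) \<longleftrightarrow> \<xi> v = length ts \<and> (\<forall>i<length ts. plane_family \<xi> (v @ [i]) (ts ! i))"
  by (auto elim: plane_family.cases intro: plane_family.intros)

lemma plane_tree_induct [case_names Plane]:
  assumes "\<And>ts. (\<And>i. i < length ts \<Longrightarrow> P (ts ! i)) \<Longrightarrow> P (Plane ts)"
  shows "P t"
  by (induction t) (auto intro!: assms)

lemma unordered_Plane:
  "unordered (Plane ts) = Vertex (image_mset (\<lambda>i. ((), unordered (ts ! i))) (mset_set {..<length ts}))"
proof -
  have "map (\<lambda>t. ((), t)) (map unordered ts) = map (\<lambda>i. ((), unordered (ts ! i))) [0..<length ts]"
    by (intro nth_equalityI) auto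
  then have "mset (map (\<lambda>t. ((), t)) (map unordered ts)) = image_mset (\<lambda>i. ((), unordered (ts ! i))) (mset [0..<length ts])"
    by (simp only: mset_map)
  then show ?thesis
    by (simp add: lessThan_atLeast0)
qed

text \<open>Through this surjection unordered trees inherit countability from plane trees, which
  permits summation over shapes.\<close>

lemma surj_unordered: "\<exists>t. unordered t = u"
proof (induction u)
  case (Vertex C)
  have "\<exists>t. unordered t = u" if "(x, u) \<in># C" for x u
    using Vertex that by fastforce
  then have "\<exists>f. \<forall>x\<in>set_mset C. unordered (f x) = snd x"
    by (intro bchoice) auto
  then obtain f where f: "\<And>x. x \<in># C \<Longrightarrow> unordered (f x) = snd x" by blast
  obtain xs where xs: "mset xs = C" using ex_mset by blast
  have "map (\<lambda>t. ((), t)) (map unordered (map f xs)) = xs"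
    using f xs by (auto simp: o_def intro!: map_idI)
  then have "unordered (Plane (map f xs)) = Vertex C"
    unfolding unordered.simps using xs by metis
  then show ?case ..
qed

lemma countable_unit_rtree: "countable (UNIV :: unit rtree set)"
proof -
  have "range unordered = UNIV" using surj_unordered by (metis surj_def)
  then show ?thesis by (metis countable_image countableI_type)
qed

text \<open>The words still carry the birth order that \<open>family_tree\<close> forgets, so a
  plane tree can be assembled child by child. Uniqueness of the unordered tree then follows from
  that of the plane one.\<close>

lemma family_tree_iff_plane_family:
  "family_tree \<xi> v u \<longleftrightarrow> (\<exists>t. plane_family \<xi> v t \<and> unordered t = u)"
proof
  assume "family_tree \<xi> v u"
  then show "\<exists>t. plane_family \<xi> v t \<and> unordered t = u"
  proof induction
    case (1 v s)
    then have "\<exists>f. \<forall>i\<in>{..<\<xi> v}. plane_family \<xi> (v @ [i]) (f i) \<and> unordered (f i) = s i"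
      by (intro bchoice) auto
    then obtain f where f: "\<And>i. i < \<xi> v \<Longrightarrow> plane_family \<xi> (v @ [i]) (f i) \<and> unordered (f i) = s i"
      by blast
    let ?ts = "map f [0..<\<xi> v]"
    have "plane_family \<xi> v (Plane ?ts)"
      unfolding plane_family_Plane using f by simp
    moreover have "unordered (Plane ?ts) = Vertex (image_mset (\<lambda>i. ((), s i)) (mset_set {..<\<xi> v}))"
      unfolding unordered_Plane using f by (auto intro!: image_mset_cong)
    ultimately show ?case by blast
  qed
next
  have "family_tree \<xi> v (unordered t)" if "plane_family \<xi> v t" for t
    using that
  proof induction
    case (1 v ts)
    then show ?case
      unfolding unordered_Plane using family_tree.intros[of \<xi> v "\<lambda>i. unordered (ts ! i)"] by simp
  qed
  then show "\<exists>t. plane_family \<xi> v t \<and> unordered t = u \<Longrightarrow> family_tree \<xi> v u" by blast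
qed

lemma plane_family_unique: "plane_family \<xi> v t \<Longrightarrow> plane_family \<xi> v t' \<Longrightarrow> t = t'"
proof (induction arbitrary: t' rule: plane_family.induct)
  case (1 v ts)
  obtain ts' where t': "t' = Plane ts'" by (cases t')
  show ?case
    using 1 unfolding t' plane_family_Plane by (auto intro!: nth_equalityI)
qed

text \<open>The progeny of \<open>v\<close> reads only words extending \<open>v\<close>. Hence the
  value forced at the progenitor \<open>[]\<close> does not affect the progeny of
  \<open>[0]\<close>.\<close>

lemma plane_family_cong:
  assumes "\<And>u. prefix v u \<Longrightarrow> \<xi> u = \<xi>' u" "plane_family \<xi> v t"
  shows "plane_family \<xi>' v t"
  using assms(2,1)
proof induction
  case (1 v ts)
  have "plane_family \<xi>' (v @ [i]) (ts ! i)" if "i < length ts" for i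
    using that by (intro 1) (auto dest: append_prefixD)
  with 1 show ?case
    unfolding plane_family_Plane by simp
qed

text \<open>
  The progenies of different children of \<open>v\<close> constrain disjoint sets of words, so the weights multiply.
\<close>

lemma plane_family_cylinder:
  "\<exists>J d. finite J \<and> (\<forall>u\<in>J. prefix v u) \<and> (\<forall>\<xi>. plane_family \<xi> v t \<longleftrightarrow> (\<forall>u\<in>J. \<xi> u = d u)) \<and>
     (\<Prod>u\<in>J. ennreal (pmf p (d u))) = weight p t"
proof (induction t arbitrary: v rule: plane_tree_induct)
  case (Plane ts)
  let ?k = "length ts"
  let ?Q = "\<lambda>i J d. finite J \<and> (\<forall>u\<in>J. prefix (v @ [i]) u) \<and>
      (\<forall>\<xi>. plane_family \<xi> (v @ [i]) (ts ! i) \<longleftrightarrow> (\<forall>u\<in>J. \<xi> u = d u)) \<and>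
      (\<Prod>u\<in>J. ennreal (pmf p (d u))) = weight p (ts ! i)"
  have "\<forall>i\<in>{..<?k}. \<exists>Jd. ?Q i (fst Jd) (snd Jd)"
  proof
    fix i assume "i \<in> {..<?k}"
    then obtain J d where "?Q i J d"
      using Plane[of i "v @ [i]"] by auto
    then show "\<exists>Jd. ?Q i (fst Jd) (snd Jd)"
      by (intro exI[of _ "(J, d)"]) simp
  qed
  from bchoice[OF this] obtain F where Q: "\<forall>i\<in>{..<?k}. ?Q i (fst (F i)) (snd (F i))"
    by blast
  have F: "\<And>i. i < ?k \<Longrightarrow> finite (fst (F i))" "\<And>i u. i < ?k \<Longrightarrow> u \<in> fst (F i) \<Longrightarrow> prefix (v @ [i]) u"
    "\<And>i \<xi>. i < ?k \<Longrightarrow> plane_family \<xi> (v @ [i]) (ts ! i) \<longleftrightarrow> (\<forall>u\<in>fst (F i). \<xi> u = snd (F i) u)"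
    "\<And>i. i < ?k \<Longrightarrow> (\<Prod>u\<in>fst (F i). ennreal (pmf p (snd (F i) u))) = weight p (ts ! i)"
    using Q by simp_all
  define J where "J i = fst (F i)" for i
  \<comment> \<open>The letter at position \<open>length v\<close> tells which child a word descends
    from, so the prescriptions for the separate children glue into one function.\<close>
  define d where "d u = (if u = v then ?k else snd (F (u ! length v)) u)" for u
  have pre: "u \<noteq> v \<and> u ! length v = i" if "i < ?k" "u \<in> J i" for i u
    using F(2)[of i u] that by (auto simp: J_def prefix_def nth_append)
  have d: "d u = snd (F i) u" if "i < ?k" "u \<in> J i" for i u
    using pre[OF that] by (simp add: d_def)
  have v: "v \<notin> (\<Union>i<?k. J i)"
    using pre by auto
  have "plane_family \<xi> v (Plane ts) \<longleftrightarrow> (\<forall>u\<in>insert v (\<Union>i<?k. J i). \<xi> u = d u)" for \<xi>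
    unfolding plane_family_Plane using F(3) d by (auto simp: J_def d_def)
  moreover have "(\<Prod>u\<in>insert v (\<Union>i<?k. J i). ennreal (pmf p (d u))) = weight p (Plane ts)"
  proof -
    have "(\<Prod>u\<in>insert v (\<Union>i<?k. J i). ennreal (pmf p (d u))) =
        ennreal (pmf p ?k) * (\<Prod>u\<in>(\<Union>i<?k. J i). ennreal (pmf p (d u)))"
      using F(1) v by (subst prod.insert) (auto simp: d_def J_def)
    also have "(\<Prod>u\<in>(\<Union>i<?k. J i). ennreal (pmf p (d u))) = (\<Prod>i<?k. \<Prod>u\<in>J i. ennreal (pmf p (d u)))"
      using F(1) pre by (intro prod.UNION_disjoint) (auto simp: J_def, metis)
    also have "\<dots> = (\<Prod>i<?k. weight p (ts ! i))"
      using F(4) d by (intro prod.cong refl) (simp add: J_def)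
    also have "\<dots> = prod_list (map (weight p) ts)"
      by (simp add: prod.list_conv_set_nth lessThan_atLeast0)
    finally show ?thesis by simp
  qed
  moreover have "\<forall>u\<in>insert v (\<Union>i<?k. J i). prefix v u"
    using F(2) by (auto simp: J_def dest: append_prefixD)
  moreover have "finite (insert v (\<Union>i<?k. J i))"
    using F(1) by (auto simp: J_def)
  ultimately show ?case by blast
qed

text \<open>Counting measure on a countable set is sigma-finite, and joint measurability with a
  countable second coordinate reduces to that of the sections.\<close>

lemma borel_measurable_nn_integral_count_space:
  fixes f :: "'a \<Rightarrow> 'b \<Rightarrow> ennreal"
  assumes "countable I" and "\<And>i. i \<in> I \<Longrightarrow> f i \<in> borel_measurable M"
  shows "(\<lambda>x. \<integral>\<^sup>+i. f i x \<partial>count_space I) \<in> borel_measurable M"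
proof -
  interpret sigma_finite_measure "count_space I"
    using assms(1) by (rule sigma_finite_measure_count_space_countable)
  have "(\<lambda>z. f (snd z) (fst z)) \<in> borel_measurable (M \<Otimes>\<^sub>M count_space I)"
    by (rule measurable_compose_countable'[where g = snd and I = I])
      (rule measurable_compose[OF measurable_fst assms(2)] measurable_snd assms(1) | assumption)+
  then show ?thesis
    by (intro borel_measurable_nn_integral) (simp add: split_beta')
qed

section \<open>The Galton-Watson law through plane progenies\<close>

abbreviation offspring_space :: "nat pmf \<Rightarrow> (nat list \<Rightarrow> nat) measure" where
  "offspring_space p \<equiv> \<Pi>\<^sub>M v\<in>UNIV. measure_pmf p"

lemma space_offspring_space: "space (offspring_space p) = UNIV"
  by (simp add: space_PiM)

lemma measurable_plane_family: "{\<xi>. plane_family \<xi> v t} \<in> sets (offspring_space p)"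
  and emeasure_plane_family: "emeasure (offspring_space p) {\<xi>. plane_family \<xi> v t} = weight p t"
proof -
  interpret product_prob_space "\<lambda>_. measure_pmf p" UNIV
    by standard
  obtain J d where J: "finite J" "\<And>\<xi>. plane_family \<xi> v t \<longleftrightarrow> (\<forall>u\<in>J. \<xi> u = d u)" "(\<Prod>u\<in>J. ennreal (pmf p (d u))) = weight p t"
    using plane_family_cylinder[of v t p] by blast
  have eq: "{\<xi>. plane_family \<xi> v t} = {\<xi> \<in> space (offspring_space p). \<forall>u\<in>J. \<xi> u \<in> {d u}}"
    by (simp add: J(2) space_PiM)
  show "{\<xi>. plane_family \<xi> v t} \<in> sets (offspring_space p)"
    unfolding eq by (intro sets.sets_Collect_finite_All J(1) sets_Collect_single) auto
  have "emeasure (offspring_space p) {\<xi>. plane_family \<xi> v t} = (\<Prod>u\<in>J. emeasure (measure_pmf p) {d u})"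
    unfolding eq using J(1) by (intro emeasure_PiM_Collect) auto
  also have "\<dots> = weight p t"
    by (simp add: emeasure_pmf_single J(3))
  finally show "emeasure (offspring_space p) {\<xi>. plane_family \<xi> v t} = weight p t" .
qed

text \<open>The only offspring of the progenitor is the word \<open>[0]\<close>, so the tree is a
  stem carrying the progeny of \<open>[0]\<close>.\<close>

lemma gw_tree_plane_family:
  assumes "plane_family \<xi> [0] t"
  shows "gw_tree \<xi> = Vertex {#((), unordered t)#}"
proof -
  have "plane_family (\<xi>([] := 1)) [0] t"
    by (rule plane_family_cong[OF _ assms]) (auto simp: prefix_def)
  then have "plane_family (\<xi>([] := 1)) [] (Plane [t])"
    by (simp add: plane_family_Plane)
  then have "plane_family (\<xi>([] := 1)) [] s \<longleftrightarrow> s = Plane [t]" for s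
    using plane_family_unique by blast
  then have "family_tree (\<xi>([] := 1)) [] u \<longleftrightarrow> u = Vertex {#((), unordered t)#}" for u
    unfolding family_tree_iff_plane_family by auto
  then show ?thesis
    unfolding gw_tree_def by (auto intro: the_equality)
qed

lemma gw_tree_infinite:
  assumes "\<And>t. \<not> plane_family \<xi> [0] t"
  shows "gw_tree \<xi> = Vertex {#}"
proof -
  have "\<not> plane_family (\<xi>([] := 1)) [] s" for s
  proof
    assume s: "plane_family (\<xi>([] := 1)) [] s"
    obtain ts where "s = Plane ts" by (cases s)
    with s have "plane_family (\<xi>([] := 1)) [] (Plane ts)" by simp
    then have "1 = length ts" and "\<forall>i<length ts. plane_family (\<xi>([] := 1)) ([] @ [i]) (ts ! i)"
      unfolding plane_family_Plane fun_upd_same by blast+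
    then have "plane_family (\<xi>([] := 1)) [0] (ts ! 0)"
      by (metis append_Nil zero_less_one)
    then have "plane_family \<xi> [0] (ts ! 0)"
      by (rule plane_family_cong[rotated]) (auto simp: prefix_def)
    with assms show False by blast
  qed
  then show ?thesis
    by (simp add: gw_tree_def family_tree_iff_plane_family)
qed

lemma measurable_gw_tree: "gw_tree \<in> measurable (offspring_space p) (count_space UNIV)"
proof (rule measurableI)
  fix A :: "unit rtree set"
  let ?T = "{t. Vertex {#((), unordered t)#} \<in> A}"
  \<comment> \<open>The second part is the event of an infinite genealogy, on which
    \<open>gw_tree\<close> takes its dummy value.\<close>
  have "gw_tree -` A = (\<Union>t\<in>?T. {\<xi>. plane_family \<xi> [0] t}) \<union>
      (if Vertex {#} \<in> A then space (offspring_space p) - (\<Union>t. {\<xi>. plane_family \<xi> [0] t}) else {})"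
    (is "_ = ?R")
  proof (rule set_eqI)
    fix \<xi>
    show "\<xi> \<in> gw_tree -` A \<longleftrightarrow> \<xi> \<in> ?R"
    proof (cases "\<exists>t. plane_family \<xi> [0] t")
      case True
      then obtain t where t: "plane_family \<xi> [0] t" by blast
      then have "plane_family \<xi> [0] s \<longleftrightarrow> s = t" for s
        using plane_family_unique by blast
      then show ?thesis
        using gw_tree_plane_family[OF t] by (auto simp: space_offspring_space)
    next
      case False
      then show ?thesis
        using gw_tree_infinite by (auto simp: space_offspring_space)
    qed
  qed
  also have "\<dots> \<in> sets (offspring_space p)"
    using measurable_plane_family by (auto intro!: sets.countable_UN' sets.Diff)
  finally show "gw_tree -` A \<inter> space (offspring_space p) \<in> sets (offspring_space p)"
    by (simp add: space_offspring_space)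
qed simp

text \<open>The plane progeny of \<open>[0]\<close> splits the offspring space into countably many
  disjoint cylinders, whose probabilities are the weights, and a remainder of infinite genealogies.
  The remainder keeps its term here, since its probability is not yet known to be 0.\<close>

lemma sum_weight_le_1: "(\<integral>\<^sup>+t. weight p t \<partial>count_space UNIV) \<le> 1"
  and nn_integral_GW:
    "(\<integral>\<^sup>+t. f t \<partial>GW p) = (\<integral>\<^sup>+t. weight p t * f (Vertex {#((), unordered t)#}) \<partial>count_space UNIV)
       + (1 - (\<integral>\<^sup>+t. weight p t \<partial>count_space UNIV)) * f (Vertex {#})"
proof -
  let ?P = "offspring_space p" and ?E = "\<lambda>t. {\<xi>. plane_family \<xi> [0] t}"
  interpret product_prob_space "\<lambda>_. measure_pmf p" "UNIV :: nat list set"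
    by standard
  have disj: "disjoint_family ?E"
    using plane_family_unique by (force simp: disjoint_family_on_def)
  have W: "emeasure ?P (\<Union>t. ?E t) = (\<integral>\<^sup>+t. weight p t \<partial>count_space UNIV)"
    using disj by (subst emeasure_UN_countable) (auto simp: emeasure_plane_family measurable_plane_family)
  show "(\<integral>\<^sup>+t. weight p t \<partial>count_space UNIV) \<le> 1"
    unfolding W[symmetric] by (rule P.emeasure_le_1)
  let ?F = "space ?P - (\<Union>t. ?E t)"
  have Fm: "?F \<in> sets ?P" by (intro sets.Diff sets.countable_UN') (auto simp: measurable_plane_family)
  have F: "emeasure ?P ?F = 1 - (\<integral>\<^sup>+t. weight p t \<partial>count_space UNIV)"
    unfolding W[symmetric]
    by (subst emeasure_compl) (auto simp: P.emeasure_space_1 intro!: sets.countable_UN' measurable_plane_family)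
  \<comment> \<open>At each \<open>\<xi>\<close> exactly one of the indicators is nonzero, so the
    sum picks out the tree that occurs, or the dummy value.\<close>
  have split: "f (gw_tree \<xi>) = (\<integral>\<^sup>+t. f (Vertex {#((), unordered t)#}) * indicator (?E t) \<xi> \<partial>count_space UNIV)
      + f (Vertex {#}) * indicator ?F \<xi>" for \<xi>
  proof (cases "\<exists>t. plane_family \<xi> [0] t")
    case True
    then obtain t where t: "plane_family \<xi> [0] t" by blast
    then have "plane_family \<xi> [0] s \<longleftrightarrow> s = t" for s
      using plane_family_unique[OF t] by blast
    then have "indicator (?E s) \<xi> = (indicator {t} s :: ennreal)" for s
      by (simp add: indicator_def)
    then have "(\<integral>\<^sup>+s. f (Vertex {#((), unordered s)#}) * indicator (?E s) \<xi> \<partial>count_space UNIV) =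
       f (Vertex {#((), unordered t)#})"
      by (simp add: nn_integral_indicator_singleton)
    moreover have "indicator ?F \<xi> = (0 :: ennreal)"
      using t by (auto simp: indicator_def)
    ultimately show ?thesis
      using gw_tree_plane_family[OF t] by simp
  next
    case False
    then have "indicator (?E s) \<xi> = (0 :: ennreal)" for s by (simp add: indicator_def)
    moreover have "indicator ?F \<xi> = (1 :: ennreal)"
      using False by (auto simp: space_offspring_space)
    ultimately show ?thesis
      using gw_tree_infinite False by simp
  qed
  have Em: "(\<lambda>\<xi>. \<integral>\<^sup>+t. f (Vertex {#((), unordered t)#}) * indicator (?E t) \<xi> \<partial>count_space UNIV) \<in> borel_measurable ?P"
    by (intro borel_measurable_nn_integral_count_space borel_measurable_times_ennreal
      borel_measurable_indicator measurable_plane_family) simp_all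
  have "(\<integral>\<^sup>+t. f t \<partial>GW p) = (\<integral>\<^sup>+\<xi>. f (gw_tree \<xi>) \<partial>?P)"
    unfolding GW_def by (intro nn_integral_distr measurable_gw_tree) simp
  also have "\<dots> = (\<integral>\<^sup>+\<xi>. (\<integral>\<^sup>+t. f (Vertex {#((), unordered t)#}) * indicator (?E t) \<xi> \<partial>count_space UNIV) \<partial>?P)
      + (\<integral>\<^sup>+\<xi>. f (Vertex {#}) * indicator ?F \<xi> \<partial>?P)"
    using Fm by (subst split, intro nn_integral_add Em borel_measurable_times_ennreal borel_measurable_indicator) simp_all
  also have "(\<integral>\<^sup>+\<xi>. f (Vertex {#}) * indicator ?F \<xi> \<partial>?P) = f (Vertex {#}) * emeasure ?P ?F"
    using Fm by (intro nn_integral_cmult_indicator)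
  also have "(\<integral>\<^sup>+\<xi>. (\<integral>\<^sup>+t. f (Vertex {#((), unordered t)#}) * indicator (?E t) \<xi> \<partial>count_space UNIV) \<partial>?P) =
      (\<integral>\<^sup>+t. (\<integral>\<^sup>+\<xi>. f (Vertex {#((), unordered t)#}) * indicator (?E t) \<xi> \<partial>?P) \<partial>count_space UNIV)"
    by (intro nn_integral_count_space_nn_integral
      borel_measurable_times_ennreal borel_measurable_indicator measurable_plane_family) simp_all
  also have "\<dots> = (\<integral>\<^sup>+t. weight p t * f (Vertex {#((), unordered t)#}) \<partial>count_space UNIV)"
    by (intro nn_integral_cong) (simp add: nn_integral_cmult_indicator measurable_plane_family emeasure_plane_family mult.commute)
  finally show "(\<integral>\<^sup>+t. f t \<partial>GW p) = (\<integral>\<^sup>+t. weight p t * f (Vertex {#((), unordered t)#}) \<partial>count_space UNIV)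
       + (1 - (\<integral>\<^sup>+t. weight p t \<partial>count_space UNIV)) * f (Vertex {#})"
    by (simp add: F mult.commute)
qed

section \<open>The branching recursion\<close>

text \<open>Distributivity: a sum of products over lists of length \<open>k\<close> is the
  \<open>k\<close>-th power of the sum, by splitting off the head. All terms are nonnegative, so the
  interchanges need no convergence conditions.\<close>

lemma nn_integral_lists_prod_list:
  fixes f :: "'a::countable \<Rightarrow> ennreal" and c :: "nat \<Rightarrow> ennreal"
  shows "(\<integral>\<^sup>+xs. c (length xs) * prod_list (map f xs) \<partial>count_space UNIV) =
    (\<Sum>k. c k * (\<integral>\<^sup>+x. f x \<partial>count_space UNIV) ^ k)"
proof -
  define h where "h k xs = indicator {k} (length xs) * prod_list (map f xs)" for k and xs :: "'a list"
  have S: "(\<integral>\<^sup>+xs. h k xs \<partial>count_space UNIV) = (\<integral>\<^sup>+x. f x \<partial>count_space UNIV) ^ k" for k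
  proof (induction k)
    case 0
    have "h 0 xs = indicator {[]} xs" for xs
      by (cases xs) (auto simp: h_def)
    then show ?case by simp
  next
    case (Suc k)
    have bij: "bij_betw (\<lambda>(x, xs). x # xs) UNIV {xs :: 'a list. xs \<noteq> []}"
      by (rule bij_betwI[where g = "\<lambda>xs. (hd xs, tl xs)"]) auto
    have "(\<integral>\<^sup>+xs. h (Suc k) xs \<partial>count_space UNIV) = (\<integral>\<^sup>+xs. h (Suc k) xs \<partial>count_space {xs. xs \<noteq> []})"
      by (intro nn_integral_count_space_eq) (auto simp: h_def)
    also have "\<dots> = (\<integral>\<^sup>+z. h (Suc k) (case z of (x, xs) \<Rightarrow> x # xs) \<partial>count_space UNIV)"
      by (rule nn_integral_bij_count_space[OF bij, symmetric])
    also have "\<dots> = (\<integral>\<^sup>+z. f (fst z) * h k (snd z) \<partial>count_space UNIV)"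
      by (intro nn_integral_cong) (auto simp: h_def indicator_def split: prod.split)
    also have "\<dots> = (\<integral>\<^sup>+x. \<integral>\<^sup>+xs. f x * h k xs \<partial>count_space UNIV \<partial>count_space UNIV)"
      by (subst nn_integral_fst_count_space[symmetric]) simp
    also have "\<dots> = (\<integral>\<^sup>+x. f x \<partial>count_space UNIV) ^ Suc k"
      by (simp add: nn_integral_cmult nn_integral_multc Suc)
    finally show ?case .
  qed
  have "c (length xs) * prod_list (map f xs) = (\<Sum>k. c k * h k xs)" for xs
    by (subst suminf_finite[where N = "{length xs}"]) (auto simp: h_def)
  then have "(\<integral>\<^sup>+xs. c (length xs) * prod_list (map f xs) \<partial>count_space UNIV) =
      (\<Sum>k. \<integral>\<^sup>+xs. c k * h k xs \<partial>count_space UNIV)"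
    by (simp add: nn_integral_suminf)
  then show ?thesis
    by (simp add: nn_integral_cmult S)
qed

lemma height_cdf_le_1:
  assumes "0 < lam"
  shows "height_cdf lam t x \<le> 1"
proof (induction t arbitrary: x)
  case (Vertex C)
  interpret prob_space "exp_law lam" using assms by (rule prob_space_exponential_density)
  have "(\<integral>\<^sup>+y. height_cdf lam t (x - y) \<partial>exp_law lam) \<le> 1" if "(a, t) \<in># C" for a t
  proof -
    have "(\<integral>\<^sup>+y. height_cdf lam t (x - y) \<partial>exp_law lam) \<le> (\<integral>\<^sup>+y. 1 \<partial>exp_law lam)"
      using Vertex that by (intro nn_integral_mono) fastforce
    then show ?thesis using emeasure_space_1 by simp
  qed
  then have "(\<Prod>(_, t)\<in>#C. \<integral>\<^sup>+y. height_cdf lam t (x - y) \<partial>exp_law lam) \<le> 1"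
    by (induction C) (auto intro!: mult_le_one simp: mult_le_one)
  then show ?case
    unfolding height_cdf_Vertex by simp
qed

lemma height_cdf_unordered_Plane:
  assumes "0 \<le> x"
  shows "height_cdf lam (unordered (Plane ts)) x =
    prod_list (map (\<lambda>t. \<integral>\<^sup>+y. height_cdf lam (unordered t) (x - y) \<partial>exp_law lam) ts)"
proof -
  have "(\<Prod>(_, t)\<in>#mset (map (\<lambda>t. ((), t)) (map unordered ts)). g t) = prod_list (map (\<lambda>t. g (unordered t)) ts)"
    for g :: "unit rtree \<Rightarrow> ennreal"
    by (induction ts) simp_all
  then show ?thesis
    unfolding unordered.simps height_cdf_Vertex using assms by (simp only: if_True)
qed

text \<open>A plane tree is the list of its branches, and both \<open>weight\<close> and
  \<open>height_cdf\<close> are products along that list. The inner integral prolongs a branch by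
  its exponential edge. For negative \<open>x\<close> the left side is 0, while the term
  \<open>k = 0\<close> on the right is \<open>pmf p 0\<close>.\<close>

lemma branching_recursion:
  assumes "0 \<le> x"
  shows "(\<integral>\<^sup>+t. weight p t * height_cdf lam (unordered t) x \<partial>count_space UNIV) =
    (\<Sum>k. ennreal (pmf p k) *
      (\<integral>\<^sup>+t. weight p t * (\<integral>\<^sup>+y. height_cdf lam (unordered t) (x - y) \<partial>exp_law lam) \<partial>count_space UNIV) ^ k)"
proof -
  let ?J = "\<lambda>t. \<integral>\<^sup>+y. height_cdf lam (unordered t) (x - y) \<partial>exp_law lam"
  have bij: "bij_betw Plane UNIV UNIV"
    by (rule bij_betwI[where g = "\<lambda>t. case t of Plane ts \<Rightarrow> ts"]) (auto split: plane_tree.split)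
  have "prod_list (map f ts) * prod_list (map g ts) = prod_list (map (\<lambda>t. f t * g t) ts)"
    for f g :: "plane_tree \<Rightarrow> ennreal" and ts
    by (induction ts) (simp_all add: ac_simps flip: mult.assoc)
  then have "weight p (Plane ts) * height_cdf lam (unordered (Plane ts)) x =
      ennreal (pmf p (length ts)) * prod_list (map (\<lambda>t. weight p t * ?J t) ts)" for ts
    unfolding height_cdf_unordered_Plane[OF assms] by (simp add: mult.assoc)
  then have "(\<integral>\<^sup>+ts. weight p (Plane ts) * height_cdf lam (unordered (Plane ts)) x \<partial>count_space UNIV) =
      (\<Sum>k. ennreal (pmf p k) * (\<integral>\<^sup>+t. weight p t * ?J t \<partial>count_space UNIV) ^ k)"
    by (simp only: nn_integral_lists_prod_list[of "\<lambda>k. ennreal (pmf p k)" "\<lambda>t. weight p t * ?J t"])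
  then show ?thesis
    by (simp only: nn_integral_bij_count_space[OF bij, of "\<lambda>t. weight p t * height_cdf lam (unordered t) x"])
qed

section \<open>The renewal equation\<close>

text \<open>The equation for the tail \<open>U\<close> is separable, but separating divides by a
  power of \<open>U\<close>, and the zero function is a solution too. Positivity therefore has to be
  settled first.\<close>

lemma extinction_ode_solution:
  fixes U :: "real \<Rightarrow> real"
  assumes q: "0 < q" "q < 1" and lam: "0 < lam" and b: "0 < b"
    and U0: "U 0 = 1" and U01: "\<And>x. x \<in> {0..b} \<Longrightarrow> U x \<in> {0..1}"
    and deriv: "\<And>x. x \<in> {0..b} \<Longrightarrow> (U has_real_derivative - (lam * q * U x powr (1 / q))) (at x within {0..b})"
  shows "U b = (lam * (1 - q) * b + 1) powr (- (q / (1 - q)))"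
proof -
  have cont: "continuous_on {0..b} U"
    using deriv by (meson continuous_on_eq_continuous_within has_field_derivative_imp_has_derivative has_derivative_continuous)
  have D: "(U has_real_derivative - (lam * q * U x powr (1 / q))) (at x)" if "0 < x" "x < b" for x
    using deriv[of x] that by (simp add: at_within_Icc_at)
  have pos: "0 < U x" if x: "x \<in> {0..b}" for x
  proof -
    \<comment> \<open>On \<open>{0..1}\<close> an exponent \<open>1 / q\<close> above 1 only
      decreases, so the derivative of \<open>U\<close> is at least \<open>- lam * q * U\<close>. The
      exponential factor turns this into monotonicity, which bounds \<open>U\<close> away from
      0.\<close>
    have "U 0 * exp (lam * q * 0) \<le> U x * exp (lam * q * x)"
    proof (rule DERIV_nonneg_imp_increasing_open[where f = "\<lambda>x. U x * exp (lam * q * x)"])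
      fix y assume y: "0 < y" "y < x"
      have "((\<lambda>x. U x * exp (lam * q * x)) has_real_derivative
          lam * q * exp (lam * q * y) * (U y - U y powr (1 / q))) (at y)"
        using y x by (auto intro!: derivative_eq_intros D simp: algebra_simps)
      moreover have "U y powr (1 / q) \<le> U y powr 1"
        using q U01[of y] x y by (intro powr_mono') (auto simp: field_simps)
      then have "0 \<le> lam * q * exp (lam * q * y) * (U y - U y powr (1 / q))"
        using q lam U01[of y] x y by auto
      ultimately show "\<exists>z. ((\<lambda>x. U x * exp (lam * q * x)) has_real_derivative z) (at y) \<and> 0 \<le> z"
        by blast
    next
      show "continuous_on {0..x} (\<lambda>x. U x * exp (lam * q * x))"
        using x by (intro continuous_intros continuous_on_subset[OF cont]) auto
    qed (use x in auto)
    then have "0 < U x * exp (lam * q * x)" using U0 by simp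
    then show ?thesis by (simp add: zero_less_mult_iff)
  qed
  let ?r = "(1 - q) / q"
  \<comment> \<open>Differentiating \<open>U powr (- ?r)\<close> gives the exponent
    \<open>- ?r - 1\<close>, which cancels the \<open>1 / q\<close> of the equation; subtracting the
    resulting linear term leaves a constant.\<close>
  define V where "V x = U x powr (- ?r) - lam * (1 - q) * x" for x
  have "V b = V 0"
  proof (rule DERIV_isconst_end[OF b])
    show "continuous_on {0..b} V"
      unfolding V_def using pos by (intro continuous_intros cont) force
    fix x assume x: "0 < x" "x < b"
    have "(V has_real_derivative
        (- ?r) * U x powr (- ?r - 1) * (- (lam * q * U x powr (1 / q))) - lam * (1 - q)) (at x)"
      unfolding V_def using pos[of x] x q
      by (auto intro!: derivative_eq_intros DERIV_fun_powr D)
    moreover have "(- ?r) * U x powr (- ?r - 1) * (- (lam * q * U x powr (1 / q))) - lam * (1 - q) = 0"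
    proof -
      have "- ?r - 1 + 1 / q = 0" using q by (simp add: field_simps)
      then have "U x powr (- ?r - 1) * U x powr (1 / q) = 1"
        using pos[of x] x by (simp flip: powr_add)
      moreover have "(- ?r) * a * (- (lam * q * b)) = lam * (1 - q) * (a * b)" for a b
        using q by (simp add: field_simps)
      ultimately show ?thesis by simp
    qed
    ultimately show "(V has_real_derivative 0) (at x)" by simp
  qed
  then have "U b powr (- ?r) = lam * (1 - q) * b + 1"
    by (simp add: V_def U0)
  moreover have "(U b powr (- ?r)) powr (- (q / (1 - q))) = U b"
  proof -
    have "- ?r * - (q / (1 - q)) = 1" using q by (simp add: field_simps)
    then show ?thesis using pos[of b] b by (simp only: powr_powr) simp
  qed
  ultimately show ?thesis by simp
qed

text \<open>Differentiating the exponential factor of the kernel contributes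
  \<open>- lam * h\<close>, which cancels the linear term of the generating function. What remains
  is the equation for the tail \<open>1 - h\<close>.\<close>

lemma renewal_equation_solution:
  fixes h :: "real \<Rightarrow> real"
  assumes q: "0 < q" "q < 1" and lam: "0 < lam" and x: "0 \<le> x"
    and h01: "\<And>x. 0 \<le> x \<Longrightarrow> h x \<in> {0..1}" and [measurable]: "h \<in> borel_measurable borel"
    and h: "\<And>x. 0 \<le> x \<Longrightarrow> ennreal (h x) =
      (\<integral>\<^sup>+u. ennreal (lam * exp (- lam * (x - u)) * (h u + q * (1 - h u) powr (1 / q))) * indicator {0..x} u \<partial>lborel)"
  shows "h x = 1 - (lam * (1 - q) * x + 1) powr (- (q / (1 - q)))"
proof -
  \<comment> \<open>With \<open>exp (- lam * x)\<close> pulled out of the kernel the integrand no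
    longer depends on \<open>x\<close>, so the convolution becomes an indefinite integral.\<close>
  define G where "G u = lam * exp (lam * u) * (h u + q * (1 - h u) powr (1 / q))" for u
  have [measurable]: "G \<in> borel_measurable borel"
    unfolding G_def by measurable
  have Gpos: "0 \<le> G u" if "0 \<le> u" for u
    using h01[OF that] q lam by (auto simp: G_def)
  have Gle: "norm (G u) \<le> lam * exp (lam * x) * 2" if "u \<in> {0..x}" for u x
  proof -
    have "(1 - h u) powr (1 / q) \<le> 1"
      using h01[of u] that q by (intro powr_le1) auto
    then have "q * (1 - h u) powr (1 / q) \<le> 1 * 1"
      using q by (intro mult_mono) auto
    then have "h u + q * (1 - h u) powr (1 / q) \<le> 2"
      using h01[of u] that by auto
    then have "G u \<le> lam * exp (lam * x) * 2"
      unfolding G_def using that lam h01[of u] q by (intro mult_mono) auto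
    then show ?thesis using Gpos[of u] that by simp
  qed
  have Gint: "set_integrable lborel {0..x} G" for x
    unfolding set_integrable_def
    by (rule integrableI_bounded_set_indicator[where B = "lam * exp (lam * x) * 2"]) (use Gle in \<open>auto simp: emeasure_lborel_Icc_eq\<close>)
  then have GI: "G integrable_on {0..x}" for x
    by (rule set_borel_integral_eq_integral(1))
  have hI: "h x = exp (- lam * x) * integral {0..x} G" if "0 \<le> x" for x
  proof -
    have "ennreal (h x) = (\<integral>\<^sup>+u. ennreal (exp (- lam * x)) * ennreal (indicator {0..x} u * G u) \<partial>lborel)"
      unfolding h[OF that]
    proof (intro nn_integral_cong)
      fix u
      have "exp (- lam * (x - u)) = exp (- lam * x) * exp (lam * u)"
        by (simp add: algebra_simps flip: exp_add)
      then have "lam * exp (- lam * (x - u)) * (h u + q * (1 - h u) powr (1 / q)) = exp (- lam * x) * G u"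
        by (simp only: G_def ac_simps)
      then show "ennreal (lam * exp (- lam * (x - u)) * (h u + q * (1 - h u) powr (1 / q))) * indicator {0..x} u =
          ennreal (exp (- lam * x)) * ennreal (indicator {0..x} u * G u)"
        by (simp only: ennreal_mult'[symmetric] exp_ge_zero) (simp add: indicator_def)
    qed
    also have "\<dots> = ennreal (exp (- lam * x)) * (\<integral>\<^sup>+u. ennreal (indicator {0..x} u * G u) \<partial>lborel)"
      by (intro nn_integral_cmult) measurable
    also have "(\<integral>\<^sup>+u. ennreal (indicator {0..x} u * G u) \<partial>lborel) = ennreal (LBINT u:{0..x}. G u)"
      using Gint[of x] Gpos unfolding set_lebesgue_integral_def set_integrable_def
      by (subst nn_integral_eq_integral) (auto simp: indicator_def)
    also have "(LBINT u:{0..x}. G u) = integral {0..x} G"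
      using Gint by (rule set_borel_integral_eq_integral(2))
    finally have "ennreal (h x) = ennreal (exp (- lam * x) * integral {0..x} G)"
      using Gpos by (simp add: ennreal_mult' integral_nonneg GI)
    moreover have "0 \<le> exp (- lam * x) * integral {0..x} G"
      by (intro mult_nonneg_nonneg integral_nonneg GI Gpos) simp_all
    moreover have "0 \<le> h x" using h01[OF that] by simp
    ultimately show ?thesis by (simp only: ennreal_inj)
  qed
  show ?thesis
  proof (cases "x = 0")
    case True
    then show ?thesis using hI[of 0] by simp
  next
    case False
    with x have b: "0 < x" by simp
    \<comment> \<open>Bootstrapping: an indefinite integral is continuous, hence so are
      \<open>h\<close> and then \<open>G\<close>, and the fundamental theorem makes \<open>h\<close>
      differentiable.\<close>
    have "continuous_on {0..x} (\<lambda>x. exp (- lam * x) * integral {0..x} G)"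
      by (intro continuous_intros indefinite_integral_continuous_1 GI)
    then have "continuous_on {0..x} h"
      by (rule continuous_on_eq) (simp add: hI)
    moreover from this have "continuous_on {0..x} (\<lambda>u. (1 - h u) powr (1 / q))"
      by (intro continuous_on_powr' continuous_on_diff continuous_on_const) (use q h01 in force)+
    ultimately have contG: "continuous_on {0..x} G"
      unfolding G_def
      by (intro continuous_on_mult continuous_on_add continuous_on_exp continuous_on_const continuous_on_id)
    have "((\<lambda>x. 1 - h x) has_real_derivative - (lam * q * (1 - h y) powr (1 / q))) (at y within {0..x})"
      if y: "y \<in> {0..x}" for y
    proof -
      have "((\<lambda>x. integral {0..x} G) has_real_derivative G y) (at y within {0..x})"
        by (rule integral_has_real_derivative[OF contG y])
      then have "((\<lambda>x. 1 - exp (- lam * x) * integral {0..x} G) has_real_derivative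
          lam * (exp (- lam * y) * integral {0..y} G) - exp (- lam * y) * G y) (at y within {0..x})"
        by (auto intro!: derivative_eq_intros)
      also have "lam * (exp (- lam * y) * integral {0..y} G) - exp (- lam * y) * G y = lam * h y - exp (- lam * y) * G y"
        using y by (subst hI) auto
      also have "exp (- lam * y) * G y = lam * (h y + q * (1 - h y) powr (1 / q))"
        by (simp add: G_def exp_minus field_simps)
      finally have "((\<lambda>x. 1 - exp (- lam * x) * integral {0..x} G) has_real_derivative
          - (lam * q * (1 - h y) powr (1 / q))) (at y within {0..x})"
        by (simp add: algebra_simps)
      then show ?thesis
        by (rule has_field_derivative_transform_within[OF _ zero_less_one y]) (simp add: hI)
    qed
    then have "1 - h x = (lam * (1 - q) * x + 1) powr (- (q / (1 - q)))"
      using h01 hI[of 0] by (intro extinction_ode_solution[OF q lam b, of "\<lambda>x. 1 - h x"]) auto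
    then show ?thesis by simp
  qed
qed

section \<open>The height of the invariant Galton-Watson tree\<close>

lemma height_cdf_neg: "x < 0 \<Longrightarrow> height_cdf lam t x = 0"
  by (cases t) (simp only: height_cdf_Vertex not_le[symmetric] if_False)

lemma nn_integral_countable_values:
  assumes X: "X \<in> measurable M (count_space UNIV)" and "countable (UNIV :: 'b set)"
  shows "(\<integral>\<^sup>+\<omega>. f (X \<omega> :: 'b) \<partial>M) = (\<integral>\<^sup>+t. f t * emeasure M {\<omega> \<in> space M. X \<omega> = t} \<partial>count_space UNIV)"
proof -
  have sets: "{\<omega> \<in> space M. X \<omega> = t} \<in> sets M" for t
    using X by measurable
  have "(\<integral>\<^sup>+\<omega>. f (X \<omega>) \<partial>M) = (\<integral>\<^sup>+\<omega>. (\<integral>\<^sup>+t. f t * indicator {\<omega> \<in> space M. X \<omega> = t} \<omega> \<partial>count_space UNIV) \<partial>M)"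
  proof (intro nn_integral_cong)
    fix \<omega> assume "\<omega> \<in> space M"
    then have "(\<integral>\<^sup>+t. f t * indicator {\<omega> \<in> space M. X \<omega> = t} \<omega> \<partial>count_space UNIV) =
        (\<integral>\<^sup>+t. f t * indicator {X \<omega>} t \<partial>count_space UNIV)"
      by (intro nn_integral_cong) (auto simp: indicator_def)
    then show "f (X \<omega>) = (\<integral>\<^sup>+t. f t * indicator {\<omega> \<in> space M. X \<omega> = t} \<omega> \<partial>count_space UNIV)"
      by (simp add: nn_integral_indicator_singleton)
  qed
  also have "\<dots> = (\<integral>\<^sup>+t. (\<integral>\<^sup>+\<omega>. f t * indicator {\<omega> \<in> space M. X \<omega> = t} \<omega> \<partial>M) \<partial>count_space UNIV)"
    using assms(2) sets by (intro nn_integral_count_space_nn_integral borel_measurable_times_ennreal) simp_all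
  also have "\<dots> = (\<integral>\<^sup>+t. f t * emeasure M {\<omega> \<in> space M. X \<omega> = t} \<partial>count_space UNIV)"
    using sets by (intro nn_integral_cong nn_integral_cmult_indicator)
  finally show ?thesis .
qed

text \<open>\<open>H\<close> measures heights from the start of the edge leading to an individual,
  \<open>\<Phi>\<close> from the individual itself. Prepending the edge makes \<open>H\<close> the
  convolution of \<open>\<Phi>\<close> with the exponential law; branching makes
  \<open>\<Phi>\<close> the generating function evaluated at \<open>H\<close>. Together they form
  the renewal equation.\<close>

lemma sum_weight_height_cdf:
  assumes q: "0 < q" "q < 1" and lam: "0 < lam" and x: "0 \<le> x"
    and gf: "\<And>z. z \<in> {0..1} \<Longrightarrow> (\<lambda>k. pmf p k * z ^ k) sums (z + q * (1 - z) powr (1 / q))"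
  shows "(\<integral>\<^sup>+t. weight p t * (\<integral>\<^sup>+y. height_cdf lam (unordered t) (x - y) \<partial>exp_law lam) \<partial>count_space UNIV) =
    ennreal (1 - (lam * (1 - q) * x + 1) powr (- (q / (1 - q))))"
proof -
  interpret E: prob_space "exp_law lam" using lam by (rule prob_space_exponential_density)
  note [measurable] = measurable_height_cdf[OF lam]
  define J where "J t x = (\<integral>\<^sup>+y. height_cdf lam (unordered t) (x - y) \<partial>exp_law lam)" for t x
  define H where "H x = (\<integral>\<^sup>+t. weight p t * J t x \<partial>count_space UNIV)" for x
  define \<Phi> where "\<Phi> x = (\<integral>\<^sup>+t. weight p t * height_cdf lam (unordered t) x \<partial>count_space UNIV)" for x
  define h where "h x = enn2real (H x)" for x
  have J1: "J t x \<le> 1" for t x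
  proof -
    have "J t x \<le> (\<integral>\<^sup>+y. 1 \<partial>exp_law lam)"
      unfolding J_def by (intro nn_integral_mono height_cdf_le_1 lam)
    then show ?thesis using E.emeasure_space_1 by simp
  qed
  have "H x \<le> (\<integral>\<^sup>+t. weight p t * 1 \<partial>count_space UNIV)" for x
    unfolding H_def by (intro nn_integral_mono mult_left_mono J1) simp
  also have "\<dots> \<le> 1" using sum_weight_le_1 by simp
  finally have H1: "H x \<le> 1" for x .
  then have Hh: "H x = ennreal (h x)" for x
    unfolding h_def by (metis ennreal_enn2real ennreal_one_less_top order_le_less_trans)
  have h01: "h x \<in> {0..1}" for x
    using H1[of x] by (simp add: h_def enn2real_leI)
  have Jm: "J t \<in> borel_measurable borel" for t
    unfolding J_def[abs_def] by measurable
  have Hm [measurable]: "H \<in> borel_measurable borel"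
    unfolding H_def[abs_def] by (intro borel_measurable_nn_integral_count_space borel_measurable_times_ennreal Jm) simp_all
  have [measurable]: "\<Phi> \<in> borel_measurable borel"
    unfolding \<Phi>_def[abs_def] by (intro borel_measurable_nn_integral_count_space borel_measurable_times_ennreal measurable_height_cdf lam) simp_all
  have \<Phi>neg: "\<Phi> u = 0" if "u < 0" for u
    using that by (simp add: \<Phi>_def height_cdf_neg)
  have \<Phi>pos: "\<Phi> u = ennreal (h u + q * (1 - h u) powr (1 / q))" if "0 \<le> u" for u
  proof -
    have "\<Phi> u = (\<Sum>k. ennreal (pmf p k) * H u ^ k)"
      unfolding \<Phi>_def H_def J_def by (rule branching_recursion[OF that])
    also have "\<dots> = (\<Sum>k. ennreal (pmf p k * h u ^ k))"
      using h01[of u] by (simp add: Hh ennreal_power ennreal_mult')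
    also have "\<dots> = ennreal (h u + q * (1 - h u) powr (1 / q))"
      using gf[OF h01] h01[of u] by (intro suminf_ennreal_eq) auto
    finally show ?thesis .
  qed
  have H\<Phi>: "H x = (\<integral>\<^sup>+y. \<Phi> (x - y) \<partial>exp_law lam)" for x
  proof -
    have "(\<integral>\<^sup>+y. \<Phi> (x - y) \<partial>exp_law lam) =
      (\<integral>\<^sup>+t. (\<integral>\<^sup>+y. weight p t * height_cdf lam (unordered t) (x - y) \<partial>exp_law lam) \<partial>count_space UNIV)"
      unfolding \<Phi>_def by (intro nn_integral_count_space_nn_integral) simp_all
    then show ?thesis
      by (simp add: H_def J_def nn_integral_cmult)
  qed
  have "ennreal (h x) = (\<integral>\<^sup>+u. ennreal (lam * exp (- lam * (x - u)) * (h u + q * (1 - h u) powr (1 / q))) * indicator {0..x} u \<partial>lborel)" for x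
  proof -
    have "ennreal (h x) = (\<integral>\<^sup>+y. ennreal (exponential_density lam y) * \<Phi> (x - y) \<partial>lborel)"
      unfolding Hh[symmetric] H\<Phi> by (subst nn_integral_density) simp_all
    \<comment> \<open>Substitution \<open>u = x - y\<close>. Afterwards the density kills
      \<open>u > x\<close> and \<open>\<Phi>\<close> kills \<open>u < 0\<close>, which confines the
      integral to \<open>{0..x}\<close>.\<close>
    also have "\<dots> = (\<integral>\<^sup>+u. ennreal (exponential_density lam (x - u)) * \<Phi> u \<partial>lborel)"
      by (subst nn_integral_real_affine[where t = x and c = "-1"]) simp_all
    also have "\<dots> = (\<integral>\<^sup>+u. ennreal (lam * exp (- lam * (x - u)) * (h u + q * (1 - h u) powr (1 / q))) * indicator {0..x} u \<partial>lborel)"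
      using lam by (intro nn_integral_cong)
        (auto simp: exponential_density_def right_diff_distrib \<Phi>neg \<Phi>pos indicator_def ennreal_mult'[symmetric] mult.commute not_le not_less)
    finally show ?thesis .
  qed
  then have "h x = 1 - (lam * (1 - q) * x + 1) powr (- (q / (1 - q)))"
    using h01 by (intro renewal_equation_solution[OF q lam x]) (auto simp: h_def[abs_def])
  then show ?thesis
    using Hh[of x] by (simp add: H_def J_def)
qed

text \<open>The weights know nothing of edge lengths, so auxiliary lengths of rate 1 may be
  attached: the height law then serves as a device for proving almost sure extinction.\<close>

lemma sum_weight_eq_1:
  assumes q: "0 < q" "q < 1"
    and gf: "\<And>z. z \<in> {0..1} \<Longrightarrow> (\<lambda>k. pmf p k * z ^ k) sums (z + q * (1 - z) powr (1 / q))"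
  shows "(\<integral>\<^sup>+t. weight p t \<partial>count_space UNIV) = 1"
proof -
  let ?W = "\<integral>\<^sup>+t. weight p t \<partial>count_space UNIV"
  let ?F = "\<lambda>x :: real. 1 - ((1 - q) * x + 1) powr (- (q / (1 - q)))"
  interpret E: prob_space "exp_law 1" by (rule prob_space_exponential_density) simp
  have "ennreal (?F x) \<le> ?W" if "0 \<le> x" for x
  proof -
    have "ennreal (?F x) = (\<integral>\<^sup>+t. weight p t * (\<integral>\<^sup>+y. height_cdf 1 (unordered t) (x - y) \<partial>exp_law 1) \<partial>count_space UNIV)"
      using sum_weight_height_cdf[OF q zero_less_one that gf] by simp
    also have "\<dots> \<le> (\<integral>\<^sup>+t. weight p t * (\<integral>\<^sup>+y. 1 \<partial>exp_law 1) \<partial>count_space UNIV)"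
      by (intro nn_integral_mono mult_left_mono height_cdf_le_1) simp_all
    finally show ?thesis using E.emeasure_space_1 by simp
  qed
  then have ev: "eventually (\<lambda>x. ennreal (?F x) \<le> ?W) at_top"
    by (rule eventually_mono[OF eventually_ge_at_top[of 0]])
  have "filterlim (\<lambda>x. (1 - q) * x + 1) at_top at_top"
    using q by real_asymp
  then have "((\<lambda>x. ((1 - q) * x + 1) powr (- (q / (1 - q)))) \<longlongrightarrow> 0) at_top"
    using q by (intro tendsto_neg_powr) auto
  then have "(?F \<longlongrightarrow> 1 - 0) at_top"
    by (intro tendsto_diff tendsto_const)
  then have "((\<lambda>x. ennreal (?F x)) \<longlongrightarrow> 1) at_top"
    using tendsto_ennrealI by fastforce
  then have "1 \<le> ?W"
    using ev by (rule tendsto_upperbound) simp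
  then show ?thesis using sum_weight_le_1 by (intro antisym)
qed

text \<open>Total weight 1 removes the dummy term of \<open>nn_integral_GW\<close>; the empty tree
  has height 0 and would otherwise contribute. The stem is the only branch at the root, so the
  product has a single factor.\<close>

lemma nn_integral_height_cdf_GW:
  assumes q: "0 < q" "q < 1" and lam: "0 < lam" and x: "0 \<le> x"
    and gf: "\<And>z. z \<in> {0..1} \<Longrightarrow> (\<lambda>k. pmf p k * z ^ k) sums (z + q * (1 - z) powr (1 / q))"
  shows "(\<integral>\<^sup>+t. height_cdf lam t x \<partial>GW p) = ennreal (1 - (lam * (1 - q) * x + 1) powr (- (q / (1 - q))))"
proof -
  have "height_cdf lam (Vertex {#((), u)#}) x = (\<integral>\<^sup>+y. height_cdf lam u (x - y) \<partial>exp_law lam)" for u :: "unit rtree"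
    using x by (simp add: height_cdf_Vertex del: height_cdf.simps)
  moreover have "(\<integral>\<^sup>+t. weight p t \<partial>count_space UNIV) = 1"
    using q gf by (rule sum_weight_eq_1)
  moreover have "(\<integral>\<^sup>+t. weight p t * (\<integral>\<^sup>+y. height_cdf lam (unordered t) (x - y) \<partial>exp_law lam) \<partial>count_space UNIV) =
      ennreal (1 - (lam * (1 - q) * x + 1) powr (- (q / (1 - q))))"
    using q lam x gf by (rule sum_weight_height_cdf)
  ultimately show ?thesis
    unfolding nn_integral_GW by (simp del: height_cdf.simps)
qed

theorem theorem5:
  fixes M :: "'w measure" and T :: "'w \<Rightarrow> real rtree" and q lam x :: real
  assumes "prob_space M"
    and "1 / 2 \<le> q" and "q < 1" and "0 < lam"
    and "IGW_distributed M T q lam"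
    and "0 \<le> x"
  shows "cdf (distr M borel (\<lambda>\<omega>. tree_height (T \<omega>))) x = \<P>(\<omega> in M. tree_height (T \<omega>) \<le> x) \<and>
         \<P>(\<omega> in M. tree_height (T \<omega>) \<le> x) = 1 - (lam * (1 - q) * x + 1) powr (- (q / (1 - q)))"
proof -
  interpret prob_space M by fact
  have T [measurable]: "T \<in> measurable M metric_tree_algebra"
    and igw: "is_IGW q (distr M (count_space UNIV) (\<lambda>\<omega>. shape (T \<omega>)))"
    and law: "\<And>t e. measure M {\<omega> \<in> space M. shape (T \<omega>) = t} > 0 \<Longrightarrow> shape e = t \<Longrightarrow> distinct_labels e \<Longrightarrow>
        distr (uniform_measure M {\<omega> \<in> space M. shape (T \<omega>) = t}) metric_tree_algebra T = exponential_lengths_law lam e"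
    using assms(5) unfolding IGW_distributed_def by blast+
  obtain p where gf: "\<And>z. z \<in> {0..1} \<Longrightarrow> (\<lambda>k. pmf p k * z ^ k) sums (z + q * (1 - z) powr (1 / q))"
    and p: "distr M (count_space UNIV) (\<lambda>\<omega>. shape (T \<omega>)) = GW p"
    using igw unfolding is_IGW_def by blast
  let ?A = "\<lambda>t. {\<omega> \<in> space M. shape (T \<omega>) = t}" and ?B = "{\<omega> \<in> space M. tree_height (T \<omega>) \<le> x}"
  let ?S = "{S \<in> space metric_tree_algebra. tree_height S \<le> x}"
  have A: "?A t \<in> sets M" for t by measurable
  have B: "?B \<in> sets M" by measurable
  have S: "?S \<in> sets metric_tree_algebra" by measurable
  \<comment> \<open>For a shape of probability 0 the hypothesis gives no conditional law, but both
    sides vanish. Otherwise any distinct naming of the shape computes the conditional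
    probability.\<close>
  have cond: "emeasure M (?A t \<inter> ?B) = height_cdf lam t x * emeasure M (?A t)" for t
  proof (cases "measure M (?A t) > 0")
    case False
    then have "emeasure M (?A t) = 0"
      using measure_nonneg[of M "?A t"] by (simp add: emeasure_eq_measure)
    moreover have "emeasure M (?A t \<inter> ?B) \<le> emeasure M (?A t)"
      using A by (intro emeasure_mono) auto
    ultimately show ?thesis by simp
  next
    case True
    obtain e where e: "shape e = t" "distinct_labels e"
      using exists_distinct_labels by blast
    have [measurable]: "(\<lambda>l. map_rtree l e) \<in> measurable (\<Pi>\<^sub>M i\<in>set_rtree e. exp_law lam) metric_tree_algebra"
      unfolding measurable_cong_sets[OF sets_PiM_exp_law refl] using e(2) by (rule measurable_map_rtree)
    have "emeasure M (?A t \<inter> ?B) / emeasure M (?A t) = emeasure (uniform_measure M (?A t)) ?B"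
      using A B by (intro emeasure_uniform_measure[symmetric])
    also have "\<dots> = emeasure (distr (uniform_measure M (?A t)) metric_tree_algebra T) ?S"
    proof -
      have "T -` ?S \<inter> space (uniform_measure M (?A t)) = ?B" by auto
      moreover have "T \<in> measurable (uniform_measure M (?A t)) metric_tree_algebra" by simp
      ultimately show ?thesis using S by (simp only: emeasure_distr)
    qed
    also have "\<dots> = emeasure (exponential_lengths_law lam e) ?S"
      by (simp only: law[OF True e])
    also have "\<dots> = emeasure (\<Pi>\<^sub>M i\<in>set_rtree e. exp_law lam)
        {l \<in> space (\<Pi>\<^sub>M i\<in>set_rtree e. exp_law lam). tree_height (map_rtree l e) \<le> x}"
      unfolding exponential_lengths_law_def using S
      by (subst emeasure_distr) (simp_all add: vimage_def Int_def conj_commute)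
    also have "\<dots> = height_cdf lam t x"
      using emeasure_tree_height_le[OF assms(4) e(2)] height_cdf_shape[of lam e] e(1) by simp
    finally have "height_cdf lam t x * emeasure M (?A t) = emeasure M (?A t \<inter> ?B) / emeasure M (?A t) * emeasure M (?A t)"
      by (simp only:)
    also have "\<dots> = emeasure M (?A t \<inter> ?B) * (emeasure M (?A t) / emeasure M (?A t))"
      by (rule ennreal_divide_times)
    also have "emeasure M (?A t) / emeasure M (?A t) = 1"
      using True by (intro ennreal_divide_self) (simp_all add: emeasure_eq_measure)
    finally show ?thesis by simp
  qed
  \<comment> \<open>Total probability over the countably many shapes; the resulting sum is an
    integral against the law of the shape, which is \<open>GW p\<close>.\<close>
  have "?B = (\<Union>t. ?A t \<inter> ?B)"
    by blast
  then have "emeasure M ?B = emeasure M (\<Union>t. ?A t \<inter> ?B)"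
    by (rule arg_cong)
  also have "\<dots> = (\<integral>\<^sup>+t. emeasure M (?A t \<inter> ?B) \<partial>count_space UNIV)"
  proof (rule emeasure_UN_countable)
    show "disjoint_family_on (\<lambda>t. ?A t \<inter> ?B) UNIV"
      unfolding disjoint_family_on_def by blast
  qed (use A B countable_unit_rtree in blast)+
  also have "\<dots> = (\<integral>\<^sup>+\<omega>. height_cdf lam (shape (T \<omega>)) x \<partial>M)"
    unfolding cond by (intro nn_integral_countable_values[symmetric] countable_unit_rtree measurable_compose[OF T] measurable_shape)
  also have "\<dots> = (\<integral>\<^sup>+t. height_cdf lam t x \<partial>GW p)"
    unfolding p[symmetric] by (intro nn_integral_distr[symmetric]) simp_all
  also have "\<dots> = ennreal (1 - (lam * (1 - q) * x + 1) powr (- (q / (1 - q))))"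
    using assms(2-4,6) by (intro nn_integral_height_cdf_GW gf) auto
  finally have "emeasure M ?B = ennreal (1 - (lam * (1 - q) * x + 1) powr (- (q / (1 - q))))" .
  \<comment> \<open>\<open>ennreal\<close> truncates negative reals to 0, so the closed form must be
    nonnegative before it can be read back as a real number.\<close>
  moreover have "(lam * (1 - q) * x + 1) powr (- (q / (1 - q))) \<le> 1"
  proof -
    have "0 \<le> lam * (1 - q) * x" using assms(3,4,6) by simp
    moreover have "- (q / (1 - q)) \<le> 0" using assms(2,3) by simp
    ultimately show ?thesis
      using powr_mono[of "- (q / (1 - q))" 0 "lam * (1 - q) * x + 1"] by (auto split: if_splits)
  qed
  ultimately have "measure M ?B = 1 - (lam * (1 - q) * x + 1) powr (- (q / (1 - q)))"
    unfolding measure_def by (simp only: enn2real_ennreal diff_ge_0_iff_ge)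
  moreover have "cdf (distr M borel (\<lambda>\<omega>. tree_height (T \<omega>))) x = measure M ?B"
  proof -
    have "(\<lambda>\<omega>. tree_height (T \<omega>)) -` {..x} \<inter> space M = ?B" by auto
    then show ?thesis
      unfolding cdf_def by (subst measure_distr) simp_all
  qed
  ultimately show ?thesis by blast
qed

end
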